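(* For $\beta>-1$ let $$G(x,t)=\frac{1}{(2\pi)^2}\int_{\mathbb{R}^2}e^{i\xi\cdot x-t(\xi_1^4+2\beta\xi_1^2\xi_2^2+\xi_2^4)}\,d\xi,\qquad x\in\mathbb{R}^2,\ t>0 .$$ For any $s>0$ the following asymptotic formulae are valid as $t\to0+$: (i) If $-1<\beta<0$ and $x=(s,s)$, then $$G(x,t)\sim\frac{1}{3^{1/2}\cdot4^{1/3}\,\pi}\,\frac{(1-\beta)^{1/6}}{(3-\beta)^{1/2}(1+\beta)^{1/6}}\,s^{-2/3}t^{-1/3}\exp\Big(-\frac{3}{4^{4/3}}\Big(\frac{1+\beta}{1-\beta}\Big)^{1/3}\frac{s^{4/3}}{t^{1/3}}\Big).$$ (ii) If $\beta=0$ and $x=(s,s)$, then $$G(x,t)\sim\frac{1}{3\cdot4^{1/3}\,\pi}\,s^{-2/3}t^{-1/3}\exp\Big(-\frac{3}{4^{4/3}}\frac{s^{4/3}}{t^{1/3}}\Big)\Big(1+\cos\Big[\frac{3\sqrt3}{4^{4/3}}\frac{s^{4/3}}{t^{1/3}}-\frac{\pi}{3}\Big]\Big).$$ (iii) If $\beta=3$ and $x=(s,0)$, then $$G(x,t)\sim\frac{1}{3\cdot4^{1/3}\,\pi}\,s^{-2/3}t^{-1/3}\exp\Big(-\frac{3}{8\cdot4^{1/3}}\frac{s^{4/3}}{t^{1/3}}\Big)\Big(1+\cos\Big[\frac{3\sqrt3}{8\cdot4^{1/3}}\frac{s^{4/3}}{t^{1/3}}-\frac{\pi}{3}\Big]\Big).$$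 (iv) If $\beta>3$ and $x=(s,0)$, then $$G(x,t)\sim\frac{1}{2^{7/6}\cdot3^{1/2}\,\pi}\,\beta^{-1/2}(\beta^2-1)^{1/6}\,s^{-2/3}t^{-1/3}\exp\Big(-\frac{3}{4^{4/3}}(\beta^2-1)^{-1/3}\frac{s^{4/3}}{t^{1/3}}\Big).$$
   Context: $G$ is the heat kernel (Green's function) of $u_t=-(\partial_{x_1}^4+2\beta\partial_{x_1}^2\partial_{x_2}^2+\partial_{x_2}^4)u$ on $\mathbb{R}^2$. Meaning of $\sim$: in (i) and (iv), $\sim$ means that the ratio of the two sides tends to $1$ as $t\to0+$. In (ii) and (iii), where the right-hand side has zeros, a relation $G(x,t)\sim C\,s^{-2/3}t^{-1/3}e^{-at^{-1/3}}\big(1+\cos(bt^{-1/3}-\pi/3)\big)$ means that $G(x,t)=C\,s^{-2/3}t^{-1/3}e^{-at^{-1/3}}\big([1+\cos(bt^{-1/3}-\pi/3)]+o(1)\big)$ as $t\to0+$. *)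

theory Defs
  imports "HOL-Analysis.Analysis" "HOL-Library.Landau_Symbols"
begin

definition quartic_symbol :: "real \<Rightarrow> real \<times> real \<Rightarrow> real" where
  "quartic_symbol \<beta> \<xi> = fst \<xi> ^ 4 + 2 * \<beta> * (fst \<xi>)\<^sup>2 * (snd \<xi>)\<^sup>2 + snd \<xi> ^ 4"

text \<open>
  The Bochner integral is zero by convention when the integrand is not integrable; here the
  integrand is absolutely integrable for \<open>\<beta> > -1\<close> and \<open>t > 0\<close>, since then
  \<open>quartic_symbol \<beta> \<xi> \<ge> c * norm \<xi> ^ 4\<close> for some \<open>c > 0\<close>.
\<close>

definition heat_kernel :: "real \<Rightarrow> real \<times> real \<Rightarrow> real \<Rightarrow> complex" where
  "heat_kernel \<beta> x t =
     of_real (1 / (2 * pi)\<^sup>2) *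
     (LINT \<xi>|lborel. exp (\<i> * of_real (\<xi> \<bullet> x) - of_real (t * quartic_symbol \<beta> \<xi>)))"

end

theory Submission
  imports
    Defs
    "HOL-Complex_Analysis.Cauchy_Integral_Theorem"
    "HOL-Probability.Distributions"
    "HOL-Real_Asymp.Real_Asymp"
begin

text \<open>
  The substitution \<open>\<xi> = \<mu> * \<eta>\<close>, with \<open>\<mu>\<close> of order \<open>(s / t) powr (1/3)\<close>, turns the exponent of
  the kernel into \<open>L * \<Phi> \<eta>\<close> with a fixed quartic polynomial \<open>\<Phi>\<close> and a parameter
  \<open>L = t * \<mu> ^ 4\<close> that tends to infinity as \<open>t\<close> tends to \<open>0\<close>. The four formulae are thus statements
  about the saddle points of \<open>\<Phi>\<close> in complex two-space. What makes these
  directions tractable is that no curved contour is needed: for a suitable \<open>\<mu>\<close> the relevant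
  saddle points have coordinates of imaginary part \<open>1\<close> or \<open>0\<close>, and it suffices to translate
  the real integration line of a coordinate by \<open>\<i>\<close> (\<open>integral_exp_quartic_shift\<close>).
  On the translated plane, or line in the separable case, the real part of the exponent attains
  its maximum at exactly two points, both nondegenerate saddle points, so Laplace's argument in the form \<open>laplace_complex_phase\<close> (rescale around the point and pass to the limit
  by dominated convergence) reduces everything to Gaussian integrals.

  Rotating \<open>\<xi>\<close> by 45 degrees maps the symbol with parameter \<open>\<beta>\<close> to a multiple of the one with
  parameter \<open>(3 - \<beta>) / (1 + \<beta>)\<close> and the diagonal to the axis (\<open>heat_kernel_rotation\<close>). It takes
  \<open>-1 < \<beta> < 0\<close> to parameters above \<open>3\<close> and \<open>0\<close> to \<open>3\<close>, so only two cases need analysis.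

  For \<open>\<beta> > 3\<close> on the axis the two maxima are \<open>(0, sqrt \<beta>)\<close> and \<open>(0, - sqrt \<beta>)\<close>, and they
  contribute the same Gaussian integral. That they are the only maxima is a completed square
  (\<open>saddle_phase_coercive\<close>) whose coefficient \<open>1 - 9 / \<beta>\<^sup>2\<close> shows the role of the threshold
  \<open>3\<close>: at \<open>\<beta> = 3\<close> further saddle points become equally high.

  For \<open>\<beta> = 0\<close> on the diagonal the kernel is the square of a one-dimensional integral. Its two
  saddle points have opposite imaginary phases, so their contributions add up to a cosine, and
  squaring it produces \<open>1 + cos\<close> of twice the angle (\<open>quartic_1d_asymptotics\<close>,
  \<open>diagonal_beta_0_asymptotics\<close>).
\<close>

section \<open>Straight contour shifts and complex Gaussian integrals\<close>
lemma tendsto_integral_symmetric_Icc: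
  fixes f :: "real \<Rightarrow> complex"
  assumes f: "integrable lborel f"
  shows "((\<lambda>R. LINT x|lborel. indicator {-R..R} x *\<^sub>R f x) \<longlongrightarrow> (LINT x|lborel. f x)) at_top"
proof (rule integral_dominated_convergence_at_top[where w = "\<lambda>x. norm (f x)"])
  show "AE x in lborel. ((\<lambda>R. indicator {-R..R} x *\<^sub>R f x) \<longlongrightarrow> f x) at_top"
  proof (rule AE_I2)
    fix x :: real
    have "\<forall>\<^sub>F R in at_top. indicator {-R..R} x *\<^sub>R f x = f x"
      using eventually_ge_at_top[of "\<bar>x\<bar>"] by eventually_elim (auto simp: abs_le_iff)
    then show "((\<lambda>R. indicator {-R..R} x *\<^sub>R f x) \<longlongrightarrow> f x) at_top"
      by (rule tendsto_eventually)
  qed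
qed (use f in \<open>auto split: split_indicator\<close>)

text \<open>
  An entire function has a primitive \<open>F\<close>, so the integrals over the two lines, cut off at real
  part \<open>-R\<close> and \<open>R\<close>, are differences of values of \<open>F\<close>. They differ by the increments of \<open>F\<close> over
  the two vertical connecting segments, which the decay hypothesis makes vanish as \<open>R\<close> grows.
  Tilted lines (\<open>b \<noteq> 0\<close>) are included because the Gaussian integrals with complex
  coefficient need them.
\<close>

lemma integral_line_shift:
  fixes f :: "complex \<Rightarrow> complex" and a b :: real and B :: "real \<Rightarrow> real"
  assumes hol: "f holomorphic_on UNIV"
    and int_real: "integrable lborel (\<lambda>x. f (of_real x))"
    and int_line: "integrable lborel (\<lambda>x. f (of_real x + \<i> * of_real (a + b * x)))"
    and bound: "\<And>z. \<bar>Im z\<bar> \<le> \<bar>a\<bar> + \<bar>b\<bar> * \<bar>Re z\<bar> \<Longrightarrow> norm (f z) \<le> B \<bar>Re z\<bar>"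
    and decay: "((\<lambda>R. B R * (\<bar>a\<bar> + \<bar>b\<bar> * R)) \<longlongrightarrow> 0) at_top"
  shows "(1 + \<i> * of_real b) * (LINT x|lborel. f (of_real x + \<i> * of_real (a + b * x)))
       = (LINT x|lborel. f (of_real x))"
proof -
  obtain F where F: "\<And>z. (F has_field_derivative f z) (at z)"
    using holomorphic_convex_primitive'[OF convex_UNIV open_UNIV hol] by auto
  have contf: "continuous_on A f" for A
    using holomorphic_on_imp_continuous_on[OF hol] continuous_on_subset by blast
  define \<gamma> where "\<gamma> x = complex_of_real x + \<i> * of_real (a + b * x)" for x
  define \<omega> where "\<omega> = 1 + \<i> * complex_of_real b"
  have d\<gamma>: "(\<gamma> has_vector_derivative \<omega>) (at x within A)" for x A
    unfolding \<gamma>_def \<omega>_def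
    by (auto intro!: derivative_eq_intros simp: has_vector_derivative_def scaleR_conv_of_real algebra_simps)
  have dr: "(complex_of_real has_vector_derivative 1) (at x within A)" for x A
    by (auto intro!: derivative_eq_intros simp: has_vector_derivative_def scaleR_conv_of_real)
  have cont\<gamma>: "continuous_on A \<gamma>" for A
    unfolding \<gamma>_def by (intro continuous_intros)
  have FTC_line: "(LINT x|lborel. indicator {-R..R} x *\<^sub>R (\<omega> * f (\<gamma> x))) = F (\<gamma> R) - F (\<gamma> (-R))"
    if "R \<ge> 0" for R
  proof (rule integral_FTC_Icc)
    fix x
    have "((F \<circ> \<gamma>) has_vector_derivative (\<omega> * f (\<gamma> x))) (at x within {-R..R})"
      by (rule field_vector_diff_chain_within[OF d\<gamma>]) (rule has_field_derivative_at_within[OF F])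
    then show "((\<lambda>x. F (\<gamma> x)) has_vector_derivative (\<omega> * f (\<gamma> x))) (at x within {-R..R})"
      by (simp add: o_def)
    show "continuous_on {-R..R} (\<lambda>x. \<omega> * f (\<gamma> x))"
      by (intro continuous_on_mult_left continuous_on_compose2[OF contf[of UNIV] cont\<gamma>] subset_UNIV)
  qed (use that in auto)
  have FTC_real: "(LINT x|lborel. indicator {-R..R} x *\<^sub>R f (of_real x)) = F (of_real R) - F (of_real (-R))"
    if "R \<ge> 0" for R
  proof (rule integral_FTC_Icc)
    fix x
    have "((F \<circ> of_real) has_vector_derivative (1 * f (of_real x))) (at x within {-R..R})"
      by (rule field_vector_diff_chain_within[OF dr]) (rule has_field_derivative_at_within[OF F])
    then show "((\<lambda>x. F (of_real x)) has_vector_derivative f (of_real x)) (at x within {-R..R})"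
      by (simp add: o_def)
    show "continuous_on {-R..R} (\<lambda>x. f (of_real x))"
      by (intro continuous_on_compose2[OF contf[of UNIV]] continuous_intros subset_UNIV)
  qed (use that in auto)
  have side: "norm (F (\<gamma> x) - F (of_real x)) \<le> B \<bar>x\<bar> * (\<bar>a\<bar> + \<bar>b\<bar> * \<bar>x\<bar>)" for x
  proof -
    let ?S = "{z. Re z = x \<and> \<bar>Im z\<bar> \<le> \<bar>a\<bar> + \<bar>b\<bar> * \<bar>x\<bar>}"
    have S: "?S = {z. Re z \<le> x} \<inter> {z. Re z \<ge> x} \<inter> {z. Im z \<le> \<bar>a\<bar> + \<bar>b\<bar> * \<bar>x\<bar>} \<inter> {z. Im z \<ge> - (\<bar>a\<bar> + \<bar>b\<bar> * \<bar>x\<bar>)}"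
      by (auto simp: abs_le_iff)
    have "convex ?S"
      unfolding S by (intro convex_Int convex_halfspace_Im_le convex_halfspace_Im_ge
          convex_halfspace_Re_le convex_halfspace_Re_ge)
    have ab: "\<bar>a + b * x\<bar> \<le> \<bar>a\<bar> + \<bar>b\<bar> * \<bar>x\<bar>"
      by (metis abs_mult abs_triangle_ineq)
    have "norm (F (\<gamma> x) - F (of_real x)) \<le> B \<bar>x\<bar> * norm (\<gamma> x - of_real x)"
    proof (rule field_differentiable_bound[OF \<open>convex ?S\<close>])
      show "(F has_field_derivative f z) (at z within ?S)" for z
        by (rule has_field_derivative_at_within[OF F])
      show "norm (f z) \<le> B \<bar>x\<bar>" if "z \<in> ?S" for z
        using bound[of z] that by auto
    qed (use ab in \<open>auto simp: \<gamma>_def\<close>)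
    also have "norm (\<gamma> x - of_real x) = \<bar>a + b * x\<bar>"
      by (simp add: \<gamma>_def norm_mult del: of_real_add of_real_mult)
    also have "B \<bar>x\<bar> * \<bar>a + b * x\<bar> \<le> B \<bar>x\<bar> * (\<bar>a\<bar> + \<bar>b\<bar> * \<bar>x\<bar>)"
    proof (rule mult_left_mono[OF ab])
      have "norm (f (of_real x)) \<le> B \<bar>x\<bar>"
        using bound[of "of_real x"] by simp
      then show "0 \<le> B \<bar>x\<bar>" using norm_ge_zero order_trans by blast
    qed
    finally show ?thesis .
  qed
  let ?I = "\<lambda>R. LINT x|lborel. indicator {-R..R} x *\<^sub>R (\<omega> * f (\<gamma> x))"
  let ?J = "\<lambda>R. LINT x|lborel. indicator {-R..R} x *\<^sub>R f (of_real x)"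
  have "((\<lambda>R. ?I R - ?J R) \<longlongrightarrow> 0) at_top"
  proof (rule Lim_null_comparison)
    show "((\<lambda>R. 2 * (B R * (\<bar>a\<bar> + \<bar>b\<bar> * R))) \<longlongrightarrow> 0) at_top"
      using tendsto_mult[OF tendsto_const[of 2] decay] by simp
    show "\<forall>\<^sub>F R in at_top. norm (?I R - ?J R) \<le> 2 * (B R * (\<bar>a\<bar> + \<bar>b\<bar> * R))"
      using eventually_ge_at_top[of 0]
    proof eventually_elim
      case (elim R)
      have "?I R - ?J R = (F (\<gamma> R) - F (of_real R)) - (F (\<gamma> (-R)) - F (of_real (-R)))"
        using FTC_line[OF elim] FTC_real[OF elim] by simp
      also have "norm \<dots> \<le> norm (F (\<gamma> R) - F (of_real R)) + norm (F (\<gamma> (-R)) - F (of_real (-R)))"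
        by (rule norm_triangle_ineq4)
      also have "\<dots> \<le> 2 * (B R * (\<bar>a\<bar> + \<bar>b\<bar> * R))"
        using side[of R] side[of "-R"] elim by simp
      finally show ?case .
    qed
  qed
  moreover have "((\<lambda>R. ?I R - ?J R) \<longlongrightarrow> (LINT x|lborel. \<omega> * f (\<gamma> x)) - (LINT x|lborel. f (of_real x))) at_top"
    by (intro tendsto_diff tendsto_integral_symmetric_Icc int_real integrable_mult_right)
       (use int_line in \<open>simp add: \<gamma>_def\<close>)
  ultimately have "(LINT x|lborel. \<omega> * f (\<gamma> x)) - (LINT x|lborel. f (of_real x)) = 0"
    by (intro tendsto_unique[OF trivial_limit_at_top_linorder])
  then show ?thesis
    by (simp add: \<gamma>_def \<omega>_def)
qed

lemma has_bochner_integral_gaussian: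
  fixes A :: real
  assumes "A > 0"
  shows "has_bochner_integral lborel (\<lambda>x. exp (- A * x\<^sup>2)) (sqrt (pi / A))"
proof -
  have "has_bochner_integral lborel (\<lambda>x::real. exp (- x\<^sup>2)) (2 * (sqrt pi / 2))"
    using has_bochner_integral_even_function[OF gaussian_moment_0] by simp
  then have "has_bochner_integral lborel (\<lambda>x. exp (- (0 + sqrt A * x)\<^sup>2)) (sqrt pi /\<^sub>R \<bar>sqrt A\<bar>)"
    using assms by (subst (asm) lborel_has_bochner_integral_real_affine_iff[of "sqrt A" _ _ 0]) auto
  then show ?thesis
    using assms by (simp add: power_mult_distrib real_sqrt_divide field_simps)
qed

lemma integrable_gaussian: "A > 0 \<Longrightarrow> integrable lborel (\<lambda>x::real. exp (- A * x\<^sup>2))"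
  using has_bochner_integral_gaussian by (auto simp: has_bochner_integral_iff)

lemma integrable_bounded_by_gaussian:
  fixes f :: "real \<Rightarrow> complex"
  assumes "continuous_on UNIV f" "A > 0" "\<And>x. norm (f x) \<le> C * exp (- A * x\<^sup>2)"
  shows "integrable lborel f"
proof (rule Bochner_Integration.integrable_bound)
  show "integrable lborel (\<lambda>x::real. C * exp (- A * x\<^sup>2))"
    by (intro integrable_mult_right integrable_gaussian assms)
  show "f \<in> borel_measurable lborel"
    using borel_measurable_continuous_onI[OF assms(1)] by simp
  show "AE x in lborel. norm (f x) \<le> norm (C * exp (- A * x\<^sup>2))"
    using assms(3) by (intro AE_I2) (auto intro: order_trans[OF _ abs_ge_self])
qed

text \<open>
  Every Gaussian integral below is of this type: the tilt \<open>b\<close> accounts for a complex quadratic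
  coefficient \<open>A * (1 + \<i> * b)\<^sup>2\<close>, the offset \<open>a\<close> for an imaginary linear term. The condition
  \<open>\<bar>b\<bar> < 1\<close> keeps the line inside the sector where \<open>exp (- A * z\<^sup>2)\<close> decays.
\<close>

lemma gaussian_line_integral:
  fixes A a b :: real
  assumes A: "A > 0" and b: "\<bar>b\<bar> < 1"
  shows "(1 + \<i> * of_real b) * (LINT x|lborel. exp (- of_real A * (of_real x + \<i> * of_real (a + b * x))\<^sup>2))
       = of_real (sqrt (pi / A))"
proof -
  define \<delta> where "\<delta> = 1 - b\<^sup>2"
  have \<delta>: "\<delta> > 0"
    using b unfolding \<delta>_def by (simp add: abs_square_less_1)
  let ?f = "\<lambda>z. exp (- complex_of_real A * z\<^sup>2)"
  have norm_f: "norm (?f z) = exp (- A * ((Re z)\<^sup>2 - (Im z)\<^sup>2))" for z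
    by (simp add: norm_exp_eq_Re power2_eq_square algebra_simps)
  have "(1 + \<i> * of_real b) * (LINT x|lborel. ?f (of_real x + \<i> * of_real (a + b * x)))
     = (LINT x|lborel. ?f (of_real x))"
  proof (rule integral_line_shift)
    show "?f holomorphic_on UNIV" by (intro holomorphic_intros)
    show "integrable lborel (\<lambda>x. ?f (of_real x))"
      by (rule integrable_bounded_by_gaussian[OF _ A, where C = 1])
        (auto intro!: continuous_intros simp: norm_f)
    show "integrable lborel (\<lambda>x. ?f (of_real x + \<i> * of_real (a + b * x)))"
    proof (rule integrable_bounded_by_gaussian[where A = "A * \<delta> / 2"])
      fix x
      \<comment> \<open>Half of the quadratic term absorbs the linear term.\<close>
      have "x\<^sup>2 - (a + b * x)\<^sup>2 = \<delta> * x\<^sup>2 - 2 * (a * b) * x - a\<^sup>2"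
        by (simp add: \<delta>_def power2_eq_square algebra_simps)
      also have "\<dots> = \<delta> / 2 * x\<^sup>2 - (a\<^sup>2 + 2 * (a * b)\<^sup>2 / \<delta>) + (\<delta> * x - 2 * (a * b))\<^sup>2 / (2 * \<delta>)"
        using \<delta> by (simp add: power2_eq_square field_simps)
      finally have "x\<^sup>2 - (a + b * x)\<^sup>2 \<ge> \<delta> / 2 * x\<^sup>2 - (a\<^sup>2 + 2 * (a * b)\<^sup>2 / \<delta>)"
        using \<delta> by simp
      then have "A * (x\<^sup>2 - (a + b * x)\<^sup>2) \<ge> A * (\<delta> / 2 * x\<^sup>2 - (a\<^sup>2 + 2 * (a * b)\<^sup>2 / \<delta>))"
        using A by simp
      then show "norm (?f (of_real x + \<i> * of_real (a + b * x)))
          \<le> exp (A * (a\<^sup>2 + 2 * (a * b)\<^sup>2 / \<delta>)) * exp (- (A * \<delta> / 2) * x\<^sup>2)"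
        unfolding norm_f exp_add[symmetric] by (simp add: algebra_simps)
    qed (use A \<delta> in \<open>auto intro!: continuous_intros\<close>)
    show "norm (?f z) \<le> exp (- A * (\<bar>Re z\<bar>\<^sup>2 - (\<bar>a\<bar> + \<bar>b\<bar> * \<bar>Re z\<bar>)\<^sup>2))"
      if "\<bar>Im z\<bar> \<le> \<bar>a\<bar> + \<bar>b\<bar> * \<bar>Re z\<bar>" for z
    proof -
      have "(Im z)\<^sup>2 \<le> (\<bar>a\<bar> + \<bar>b\<bar> * \<bar>Re z\<bar>)\<^sup>2"
        using power_mono[OF that abs_ge_zero, of 2] by simp
      then show ?thesis
        using A unfolding norm_f by simp
    qed
    have "((\<lambda>R. exp (- A * (\<delta> * R\<^sup>2 - 2 * \<bar>a\<bar> * \<bar>b\<bar> * R - a\<^sup>2)) * (\<bar>a\<bar> + \<bar>b\<bar> * R)) \<longlongrightarrow> 0) at_top"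
      using A \<delta> by real_asymp
    then show "((\<lambda>R. exp (- A * (R\<^sup>2 - (\<bar>a\<bar> + \<bar>b\<bar> * R)\<^sup>2)) * (\<bar>a\<bar> + \<bar>b\<bar> * R)) \<longlongrightarrow> 0) at_top"
      by (simp add: \<delta>_def power2_eq_square algebra_simps)
  qed
  also have "(LINT x|lborel. ?f (of_real x)) = (LINT x|lborel. complex_of_real (exp (- A * x\<^sup>2)))"
    by (simp add: exp_of_real[symmetric])
  also have "\<dots> = of_real (sqrt (pi / A))"
    using has_bochner_integral_gaussian[OF A] by (simp add: has_bochner_integral_iff)
  finally show ?thesis .
qed

section \<open>Laplace asymptotics with a complex phase\<close>

lemma lborel_integral_affine:
  fixes h :: "'a::euclidean_space \<Rightarrow> complex"
  assumes [measurable]: "h \<in> borel_measurable borel" and "c > 0"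
  shows "(LINT x|lborel. h x) = of_real (c ^ DIM('a)) * (LINT y|lborel. h (a + c *\<^sub>R y))"
proof -
  have "(LINT x|lborel. h x) =
      (LINT x|density (distr lborel borel (\<lambda>y. a + c *\<^sub>R y)) (\<lambda>_. \<bar>c\<bar> ^ DIM('a)). h x)"
    using lborel_affine[of c a] assms(2) by simp
  also have "\<dots> = (LINT x|distr lborel borel (\<lambda>y. a + c *\<^sub>R y). \<bar>c\<bar> ^ DIM('a) *\<^sub>R h x)"
    using assms by (subst integral_density) auto
  also have "\<dots> = (LINT y|lborel. \<bar>c\<bar> ^ DIM('a) *\<^sub>R h (a + c *\<^sub>R y))"
    by (subst integral_distr) auto
  finally show ?thesis
    using assms(2) by (simp add: scaleR_conv_of_real)
qed

text \<open>
  Rescaling \<open>x = x0 + y / k\<close> turns the integral into one of \<open>exp (- k\<^sup>2 * \<Psi> (x0 + y / k))\<close>, whose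
  exponent converges pointwise to \<open>- q y\<close> and whose modulus is dominated by a fixed Gaussian
  thanks to coercivity. The set \<open>S\<close> isolates a single minimum of \<open>Re \<Psi>\<close>; its
  indicator disappears in the limit since \<open>x0\<close> is an interior point.
\<close>

lemma laplace_complex_phase:
  fixes \<Psi> q :: "'a::euclidean_space \<Rightarrow> complex" and c :: real
  assumes [measurable]: "\<Psi> \<in> borel_measurable borel" "q \<in> borel_measurable borel" "S \<in> sets borel"
    and x0: "x0 \<in> interior S"
    and gauss: "integrable lborel (\<lambda>y::'a. exp (- c * (norm y)\<^sup>2))"
    and coercive: "\<And>x. x \<in> S \<Longrightarrow> c * (norm (x - x0))\<^sup>2 \<le> Re (\<Psi> x)"
    and quadratic: "\<And>y. ((\<lambda>k. of_real (k\<^sup>2) * \<Psi> (x0 + (1 / k) *\<^sub>R y)) \<longlongrightarrow> q y) at_top"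
  shows "((\<lambda>k. of_real (k ^ DIM('a)) * (LINT x:S|lborel. exp (- of_real (k\<^sup>2) * \<Psi> x)))
           \<longlongrightarrow> (LINT y|lborel. exp (- q y))) at_top"
proof -
  define h where "h k x = indicator S x *\<^sub>R exp (- of_real (k\<^sup>2) * \<Psi> x)" for k x
  have [measurable]: "h k \<in> borel_measurable borel" for k
    unfolding h_def by measurable
  have "((\<lambda>k. LINT y|lborel. h k (x0 + (1 / k) *\<^sub>R y)) \<longlongrightarrow> (LINT y|lborel. exp (- q y))) at_top"
  proof (rule integral_dominated_convergence_at_top[OF _ _ gauss])
    show "AE y in lborel. ((\<lambda>k. h k (x0 + (1 / k) *\<^sub>R y)) \<longlongrightarrow> exp (- q y)) at_top"
    proof (rule AE_I2)
      fix y :: 'a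
      have "((\<lambda>k::real. x0 + (1 / k) *\<^sub>R y) \<longlongrightarrow> x0 + 0 *\<^sub>R y) at_top"
        by (intro tendsto_add tendsto_scaleR tendsto_const tendsto_divide_0[OF tendsto_const]
            filterlim_at_top_imp_at_infinity filterlim_ident)
      then have "\<forall>\<^sub>F k in at_top. x0 + (1 / k) *\<^sub>R y \<in> interior S"
        using x0 by (intro topological_tendstoD[where S = "interior S"]) auto
      then have "\<forall>\<^sub>F k in at_top. exp (- (of_real (k\<^sup>2) * \<Psi> (x0 + (1 / k) *\<^sub>R y)))
          = h k (x0 + (1 / k) *\<^sub>R y)"
      proof eventually_elim
        case (elim k)
        then have "x0 + (1 / k) *\<^sub>R y \<in> S" using interior_subset by blast
        then show ?case by (simp add: h_def)
      qed
      moreover have "((\<lambda>k. exp (- (of_real (k\<^sup>2) * \<Psi> (x0 + (1 / k) *\<^sub>R y)))) \<longlongrightarrow> exp (- q y)) at_top"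
        by (intro tendsto_exp tendsto_minus quadratic)
      ultimately show "((\<lambda>k. h k (x0 + (1 / k) *\<^sub>R y)) \<longlongrightarrow> exp (- q y)) at_top"
        by (rule Lim_transform_eventually[rotated])
    qed
    show "\<forall>\<^sub>F k in at_top. AE y in lborel. norm (h k (x0 + (1 / k) *\<^sub>R y)) \<le> exp (- c * (norm y)\<^sup>2)"
      using eventually_gt_at_top[of 0]
    proof (eventually_elim, intro AE_I2)
      fix k :: real and y :: 'a
      assume k: "k > 0"
      have "exp (- (k\<^sup>2 * Re (\<Psi> (x0 + (1 / k) *\<^sub>R y)))) \<le> exp (- c * (norm y)\<^sup>2)"
        if "x0 + (1 / k) *\<^sub>R y \<in> S"
      proof -
        have "k\<^sup>2 * (c * (norm ((1 / k) *\<^sub>R y))\<^sup>2) \<le> k\<^sup>2 * Re (\<Psi> (x0 + (1 / k) *\<^sub>R y))"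
          using coercive[OF that] by (intro mult_left_mono) auto
        also have "k\<^sup>2 * (c * (norm ((1 / k) *\<^sub>R y))\<^sup>2) = c * (norm y)\<^sup>2"
          using k by (simp add: power_divide)
        finally show ?thesis by simp
      qed
      then show "norm (h k (x0 + (1 / k) *\<^sub>R y)) \<le> exp (- c * (norm y)\<^sup>2)"
        by (auto simp: h_def norm_exp_eq_Re simp flip: of_real_power split: split_indicator)
    qed
  qed auto
  moreover have "\<forall>\<^sub>F k in at_top. (LINT y|lborel. h k (x0 + (1 / k) *\<^sub>R y)) =
      of_real (k ^ DIM('a)) * (LINT x:S|lborel. exp (- of_real (k\<^sup>2) * \<Psi> x))"
    using eventually_gt_at_top[of 0]
  proof eventually_elim
    case (elim k)
    have "(LINT x|lborel. h k x) = of_real ((1 / k) ^ DIM('a)) * (LINT y|lborel. h k (x0 + (1 / k) *\<^sub>R y))"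
      by (rule lborel_integral_affine) (use elim in auto)
    then show ?case
      using elim by (simp add: h_def set_lebesgue_integral_def power_divide)
  qed
  ultimately show ?thesis
    by (rule Lim_transform_eventually)
qed

section \<open>The heat kernel integral and its rotation by 45 degrees\<close>

lemma integrable_gaussian_prod:
  assumes "A > 0"
  shows "integrable lborel (\<lambda>z::real \<times> real. exp (- A * (norm z)\<^sup>2))"
proof -
  have "integrable (lborel \<Otimes>\<^sub>M lborel) (\<lambda>(x, y). exp (- A * x\<^sup>2) * exp (- A * (y::real)\<^sup>2))"
  proof (rule lborel_pair.Fubini_integrable)
    show "integrable lborel (\<lambda>x. LINT y|lborel. norm (case (x, y) of (x, y) \<Rightarrow> exp (- A * x\<^sup>2) * exp (- A * (y::real)\<^sup>2)))"
      using integrable_gaussian[OF assms] by (simp add: abs_mult)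
    show "AE x in lborel. integrable lborel (\<lambda>y. case (x, y) of (x, y) \<Rightarrow> exp (- A * x\<^sup>2) * exp (- A * (y::real)\<^sup>2))"
      using integrable_gaussian[OF assms] by simp
  qed measurable
  moreover have "exp (- A * (norm z)\<^sup>2) = (case z of (x, y) \<Rightarrow> exp (- A * x\<^sup>2) * exp (- A * y\<^sup>2))" for z :: "real \<times> real"
    by (cases z) (simp add: norm_Pair exp_add[symmetric] algebra_simps)
  ultimately show ?thesis
    by (simp add: lborel_prod case_prod_unfold)
qed

lemma integrable_bounded_by_gaussian_prod:
  fixes f :: "real \<times> real \<Rightarrow> complex"
  assumes "continuous_on UNIV f" "A > 0" "\<And>z. norm (f z) \<le> C * exp (- A * (norm z)\<^sup>2)"
  shows "integrable lborel f"
proof (rule Bochner_Integration.integrable_bound)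
  show "integrable lborel (\<lambda>z::real \<times> real. C * exp (- A * (norm z)\<^sup>2))"
    by (intro integrable_mult_right integrable_gaussian_prod assms)
  show "f \<in> borel_measurable lborel"
    using borel_measurable_continuous_onI[OF assms(1)] by simp
  show "AE z in lborel. norm (f z) \<le> norm (C * exp (- A * (norm z)\<^sup>2))"
    using assms(3) by (intro AE_I2) (auto intro: order_trans[OF _ abs_ge_self])
qed

lemma integral_lborel_fst:
  fixes f :: "real \<times> real \<Rightarrow> complex"
  assumes "integrable lborel f"
  shows "(LINT z|lborel. f z) = (LINT x|lborel. LINT y|lborel. f (x, y))"
  using lborel_pair.integral_fst'[of f] assms by (simp add: lborel_prod)

lemma integral_lborel_snd:
  fixes f :: "real \<times> real \<Rightarrow> complex"
  assumes "integrable lborel f"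
  shows "(LINT z|lborel. f z) = (LINT y|lborel. LINT x|lborel. f (x, y))"
  using lborel_pair.integral_snd[of "\<lambda>x y. f (x, y)"] assms by (simp add: lborel_prod)

lemma quartic_symbol_ge:
  assumes "\<beta> > -1"
  shows "min 1 ((1 + \<beta>) / 2) * (norm \<xi>) ^ 4 \<le> quartic_symbol \<beta> \<xi>"
proof -
  obtain a b where \<xi>: "\<xi> = (a, b)" by (cases \<xi>)
  have n: "(norm \<xi>) ^ 4 = (a\<^sup>2 + b\<^sup>2)\<^sup>2"
    by (simp add: \<xi> norm_Pair power4_eq_xxxx power2_eq_square[of "a\<^sup>2 + b\<^sup>2"] mult.assoc)
  have q: "quartic_symbol \<beta> \<xi> = (a\<^sup>2 + b\<^sup>2)\<^sup>2 + 2 * (\<beta> - 1) * (a\<^sup>2 * b\<^sup>2)"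
    by (simp add: \<xi> quartic_symbol_def power2_eq_square power4_eq_xxxx algebra_simps)
  show ?thesis
  proof (cases "\<beta> \<ge> 1")
    case True
    then have "0 \<le> 2 * (\<beta> - 1) * (a\<^sup>2 * b\<^sup>2)" by simp
    then show ?thesis using True unfolding n q by simp
  next
    case False
    have "0 \<le> (a\<^sup>2 - b\<^sup>2)\<^sup>2" by simp
    then have "4 * (a\<^sup>2 * b\<^sup>2) \<le> (a\<^sup>2 + b\<^sup>2)\<^sup>2"
      by (simp add: power2_eq_square algebra_simps)
    then have "(1 - \<beta>) * (4 * (a\<^sup>2 * b\<^sup>2)) \<le> (1 - \<beta>) * (a\<^sup>2 + b\<^sup>2)\<^sup>2"
      using False by (intro mult_left_mono) auto
    then show ?thesis
      using False unfolding n q by (simp add: min_def field_simps)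
  qed
qed

text \<open>
  Quartic decay is stronger than Gaussian decay, up to a constant, because
  \<open>c * r ^ 4 - r\<^sup>2 + 1 / (4 * c)\<close> is a square divided by \<open>4 * c\<close>. The Gaussian form is preferred since it is
  stable under the linear substitutions used below.
\<close>

lemma heat_integrand_gaussian_bound:
  fixes \<beta> t :: real
  assumes "\<beta> > -1" "t > 0"
  shows "\<exists>C. \<forall>\<xi>. norm (exp (\<i> * of_real (\<xi> \<bullet> x) - of_real (t * quartic_symbol \<beta> \<xi>))) \<le> C * exp (- 1 * (norm \<xi>)\<^sup>2)"
proof (intro exI allI)
  define c where "c = t * min 1 ((1 + \<beta>) / 2)"
  have c: "c > 0" using assms by (auto simp: c_def)
  fix \<xi> :: "real \<times> real"
  have "0 \<le> (2 * c * (norm \<xi>)\<^sup>2 - 1)\<^sup>2 / (4 * c)"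
    using c by simp
  also have "\<dots> = c * (norm \<xi>) ^ 4 - (norm \<xi>)\<^sup>2 + 1 / (4 * c)"
    using c by (simp add: power2_eq_square power4_eq_xxxx field_simps)
  also have "c * (norm \<xi>) ^ 4 \<le> t * quartic_symbol \<beta> \<xi>"
    using mult_left_mono[OF quartic_symbol_ge[OF assms(1)], of t] assms(2) by (simp add: c_def mult.assoc)
  finally show "norm (exp (\<i> * of_real (\<xi> \<bullet> x) - of_real (t * quartic_symbol \<beta> \<xi>)))
      \<le> exp (1 / (4 * c)) * exp (- 1 * (norm \<xi>)\<^sup>2)"
    by (simp add: norm_exp_eq_Re flip: exp_add)
qed

lemma continuous_on_heat_integrand:
  "continuous_on UNIV (\<lambda>\<xi>. exp (\<i> * of_real (\<xi> \<bullet> x) - of_real (t * quartic_symbol \<beta> \<xi>)))"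
  unfolding quartic_symbol_def by (intro continuous_intros)

lemma integrable_heat_integrand:
  assumes "\<beta> > -1" "t > 0"
  shows "integrable lborel (\<lambda>\<xi>. exp (\<i> * of_real (\<xi> \<bullet> x) - of_real (t * quartic_symbol \<beta> \<xi>)))"
  using heat_integrand_gaussian_bound[OF assms, of x] integrable_bounded_by_gaussian_prod[OF continuous_on_heat_integrand, of 1]
  by fastforce

text \<open>
  The substitution of determinant \<open>-1/2\<close> is performed as two one-dimensional affine ones,
  exchanging the order of integration in between.
\<close>

lemma integral_eq_half_rotated_integral:
  fixes f :: "real \<times> real \<Rightarrow> complex"
  assumes cont: "continuous_on UNIV f" and A: "A > 0" and bound: "\<And>z. norm (f z) \<le> C * exp (- A * (norm z)\<^sup>2)"
  shows "(LINT z|lborel. f z) = of_real (1 / 2) * (LINT z|lborel. f ((fst z + snd z) / 2, (fst z - snd z) / 2))"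
proof -
  have C: "C \<ge> 0"
  proof -
    have "0 \<le> C * exp (- A * (norm (0 :: real \<times> real))\<^sup>2)"
      using bound[of 0] norm_ge_zero order_trans by blast
    then show ?thesis by simp
  qed
  have linear_bound: "norm (f z') \<le> C * exp (- (A / 4) * (norm z)\<^sup>2)" if "(norm z)\<^sup>2 / 4 \<le> (norm z')\<^sup>2"
    for z z' :: "real \<times> real"
  proof (rule order_trans[OF bound mult_left_mono[OF _ C]])
    have "A * ((norm z)\<^sup>2 / 4) \<le> A * (norm z')\<^sup>2"
      using that A by (intro mult_left_mono) auto
    then show "exp (- A * (norm z')\<^sup>2) \<le> exp (- (A / 4) * (norm z)\<^sup>2)" by simp
  qed
  have norm2: "(norm z)\<^sup>2 = (fst z)\<^sup>2 + (snd z)\<^sup>2" for z :: "real \<times> real"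
    by (cases z) (simp add: norm_Pair)
  have int1: "integrable lborel (\<lambda>z. f (fst z + snd z, snd z))"
  proof (rule integrable_bounded_by_gaussian_prod[where A = "A / 4" and C = C])
    fix z :: "real \<times> real"
    \<comment> \<open>This sum of squares is \<open>4 * (x + y)\<^sup>2 + 4 * y\<^sup>2 - x\<^sup>2 - y\<^sup>2\<close> for \<open>z = (x, y)\<close>.\<close>
    have "0 \<le> 3 * (fst z + 4 / 3 * snd z)\<^sup>2 + 5 / 3 * (snd z)\<^sup>2" by simp
    then have "(norm z)\<^sup>2 / 4 \<le> (norm (fst z + snd z, snd z))\<^sup>2"
      unfolding norm2 by (simp add: power2_eq_square algebra_simps)
    then show "norm (f (fst z + snd z, snd z)) \<le> C * exp (- (A / 4) * (norm z)\<^sup>2)"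
      by (rule linear_bound)
  qed (use A in \<open>auto intro!: continuous_intros continuous_on_compose2[OF cont]\<close>)
  have int2: "integrable lborel (\<lambda>z. f ((fst z + snd z) / 2, (fst z - snd z) / 2))"
  proof (rule integrable_bounded_by_gaussian_prod[where A = "A / 4" and C = C])
    fix z :: "real \<times> real"
    have "(norm z)\<^sup>2 / 4 \<le> (norm ((fst z + snd z) / 2, (fst z - snd z) / 2))\<^sup>2"
      unfolding norm2 by (simp add: power2_eq_square field_simps)
    then show "norm (f ((fst z + snd z) / 2, (fst z - snd z) / 2)) \<le> C * exp (- (A / 4) * (norm z)\<^sup>2)"
      by (rule linear_bound)
  qed (use A in \<open>auto intro!: continuous_intros continuous_on_compose2[OF cont]\<close>)
  have "(LINT z|lborel. f z) = (LINT y|lborel. LINT x|lborel. f (x, y))"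
    by (rule integral_lborel_snd) (rule integrable_bounded_by_gaussian_prod[OF cont A bound])
  also have "\<dots> = (LINT y|lborel. LINT v|lborel. f (v + y, y))"
    by (subst lborel_integral_real_affine[where c = 1 and f = "\<lambda>x. f (x, y)" and t = y for y]) (simp_all add: add.commute)
  also have "\<dots> = (LINT z|lborel. f (fst z + snd z, snd z))"
    using integral_lborel_snd[OF int1] by simp
  also have "\<dots> = (LINT v|lborel. LINT y|lborel. f (v + y, y))"
    using integral_lborel_fst[OF int1] by simp
  also have "\<dots> = (LINT v|lborel. of_real (1 / 2) * (LINT u|lborel. f ((u + v) / 2, (u - v) / 2)))"
  proof (rule Bochner_Integration.integral_cong[OF refl])
    fix v :: real
    have "(LINT y|lborel. f (v + y, y)) = (1 / 2) *\<^sub>R (LINT u|lborel. f (v + (- v / 2 + (1 / 2) * u), - v / 2 + (1 / 2) * u))"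
      by (subst lborel_integral_real_affine[where c = "1 / 2" and t = "- v / 2"]) simp_all
    also have "(\<lambda>u. f (v + (- v / 2 + (1 / 2) * u), - v / 2 + (1 / 2) * u)) = (\<lambda>u. f ((u + v) / 2, (u - v) / 2))"
      by (intro ext arg_cong[where f = f]) (simp add: field_simps)
    finally show "(LINT y|lborel. f (v + y, y)) = of_real (1 / 2) * (LINT u|lborel. f ((u + v) / 2, (u - v) / 2))"
      by (simp add: scaleR_conv_of_real)
  qed
  also have "\<dots> = of_real (1 / 2) * (LINT z|lborel. f ((fst z + snd z) / 2, (fst z - snd z) / 2))"
    using integral_lborel_snd[OF int2] by simp
  finally show ?thesis .
qed

text \<open>
  With \<open>u = \<xi>\<^sub>1 + \<xi>\<^sub>2\<close> and \<open>v = \<xi>\<^sub>1 - \<xi>\<^sub>2\<close> the symbol becomes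
  \<open>((1 + \<beta>) * (u ^ 4 + v ^ 4) + (6 - 2 * \<beta>) * u\<^sup>2 * v\<^sup>2) / 8\<close>, and the linear form
  \<open>s * (\<xi>\<^sub>1 + \<xi>\<^sub>2)\<close> becomes \<open>s * u\<close>.
\<close>

lemma heat_kernel_rotation:
  assumes \<beta>: "\<beta> > -1" and t: "t > 0"
  shows "heat_kernel \<beta> (s, s) t = of_real (1 / 2) * heat_kernel ((3 - \<beta>) / (1 + \<beta>)) (s, 0) ((1 + \<beta>) / 8 * t)"
proof -
  obtain C where C: "\<And>\<xi>. norm (exp (\<i> * of_real (\<xi> \<bullet> (s, s)) - of_real (t * quartic_symbol \<beta> \<xi>))) \<le> C * exp (- 1 * (norm \<xi>)\<^sup>2)"
    using heat_integrand_gaussian_bound[OF assms] by blast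
  have q: "t * quartic_symbol \<beta> ((fst z + snd z) / 2, (fst z - snd z) / 2)
      = (1 + \<beta>) / 8 * t * quartic_symbol ((3 - \<beta>) / (1 + \<beta>)) z" for z
    using \<beta> by (simp add: quartic_symbol_def field_simps power2_eq_square power4_eq_xxxx)
  have i: "((fst z + snd z) / 2, (fst z - snd z) / 2) \<bullet> (s, s) = z \<bullet> (s, 0)" for z :: "real \<times> real"
    by (cases z) (simp add: field_simps)
  show ?thesis
    unfolding heat_kernel_def integral_eq_half_rotated_integral[OF continuous_on_heat_integrand zero_less_one C] q i
    by (simp add: mult.left_commute)
qed

section \<open>Shifting a quartic exponential by the imaginary unit\<close>

lemma norm_exp_quartic:
  fixes L a b c :: real
  shows "norm (exp (of_real L * (\<i> * of_real a * z - z ^ 4 - of_real b * z\<^sup>2 + of_real c)))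
    = exp (L * (- a * Im z - ((Re z) ^ 4 - 6 * (Re z)\<^sup>2 * (Im z)\<^sup>2 + (Im z) ^ 4)
             - b * ((Re z)\<^sup>2 - (Im z)\<^sup>2) + c))"
  unfolding norm_exp_eq_Re
  by (cases z) (simp add: complex_eq_iff power2_eq_square power4_eq_xxxx algebra_simps)

text \<open>
  Both one-dimensional shifts of the proof are instances: \<open>b = c = 0\<close> for the separable case, and
  \<open>b = 2 * \<beta> * v\<^sup>2\<close>, \<open>c = - v ^ 4\<close> for the first coordinate at a fixed value \<open>v\<close> of the second one. On the
  strip of height \<open>1\<close> the integrand is bounded by a Gaussian in the real part.
\<close>

lemma integral_exp_quartic_shift:
  fixes L a b c :: real
  defines "f \<equiv> \<lambda>z. exp (of_real L * (\<i> * of_real a * z - z ^ 4 - of_real b * z\<^sup>2 + of_real c))"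
  assumes L: "L > 0" and a: "a \<ge> 0" and b: "b \<ge> 0"
  shows "(LINT x|lborel. f (of_real x)) = (LINT x|lborel. f (of_real x + \<i>))"
proof -
  define C where "C = exp (L * (a + b + c + 49 / 4))"
  have bound: "norm (f z) \<le> C * exp (- L * (Re z)\<^sup>2)" if "\<bar>Im z\<bar> \<le> 1" for z
  proof -
    have y2: "(Im z)\<^sup>2 \<le> 1"
      using that by (simp add: abs_square_le_1)
    have 1: "- a * Im z \<le> a"
      using mult_left_mono[of "- Im z" 1 a] that a by (simp add: abs_le_iff)
    have 2: "6 * (Re z)\<^sup>2 * (Im z)\<^sup>2 \<le> 6 * (Re z)\<^sup>2 * 1"
      using y2 by (intro mult_left_mono) auto
    have 3: "b * (Im z)\<^sup>2 \<le> b * 1" "0 \<le> b * (Re z)\<^sup>2"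
      using mult_left_mono[OF y2 b] b by auto
    have 4: "0 \<le> ((Re z)\<^sup>2 - 7 / 2)\<^sup>2" "0 \<le> (Im z) ^ 4"
      by auto
    have "((Re z)\<^sup>2 - 7 / 2)\<^sup>2 = (Re z) ^ 4 - 7 * (Re z)\<^sup>2 + 49 / 4"
      by (simp add: power2_eq_square power4_eq_xxxx algebra_simps)
    then have "- a * Im z - ((Re z) ^ 4 - 6 * (Re z)\<^sup>2 * (Im z)\<^sup>2 + (Im z) ^ 4)
             - b * ((Re z)\<^sup>2 - (Im z)\<^sup>2) + c \<le> (a + b + c + 49 / 4) - (Re z)\<^sup>2"
      using 1 2 3 4 unfolding right_diff_distrib by linarith
    then have "L * (- a * Im z - ((Re z) ^ 4 - 6 * (Re z)\<^sup>2 * (Im z)\<^sup>2 + (Im z) ^ 4)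
             - b * ((Re z)\<^sup>2 - (Im z)\<^sup>2) + c) \<le> L * ((a + b + c + 49 / 4) - (Re z)\<^sup>2)"
      using L by (intro mult_left_mono) auto
    then show ?thesis
      unfolding f_def norm_exp_quartic C_def exp_add[symmetric] by (simp add: right_diff_distrib)
  qed
  have "(1 + \<i> * of_real 0) * (LINT x|lborel. f (of_real x + \<i> * of_real (1 + 0 * x)))
       = (LINT x|lborel. f (of_real x))"
  proof (rule integral_line_shift)
    show "f holomorphic_on UNIV"
      unfolding f_def by (intro holomorphic_intros)
    show "integrable lborel (\<lambda>x. f (of_real x))"
    proof (rule integrable_bounded_by_gaussian[OF _ L, where C = C])
      show "norm (f (of_real x)) \<le> C * exp (- L * x\<^sup>2)" for x
        using bound[of "of_real x"] by simp
    qed (auto simp: f_def intro!: continuous_intros)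
    show "integrable lborel (\<lambda>x. f (of_real x + \<i> * of_real (1 + 0 * x)))"
    proof (rule integrable_bounded_by_gaussian[OF _ L, where C = C])
      show "norm (f (of_real x + \<i> * of_real (1 + 0 * x))) \<le> C * exp (- L * x\<^sup>2)" for x
        using bound[of "of_real x + \<i>"] by simp
    qed (auto simp: f_def intro!: continuous_intros)
    show "norm (f z) \<le> C * exp (- L * \<bar>Re z\<bar>\<^sup>2)" if "\<bar>Im z\<bar> \<le> \<bar>1\<bar> + \<bar>0\<bar> * \<bar>Re z\<bar>" for z
      using bound[of z] that by simp
    show "((\<lambda>R. C * exp (- L * R\<^sup>2) * (\<bar>1\<bar> + \<bar>0\<bar> * R)) \<longlongrightarrow> 0) at_top"
      using L by real_asymp
  qed
  then show ?thesis by simp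
qed

section \<open>The separable cases: beta = 0 on the diagonal, beta = 3 on the axis\<close>

text \<open>
  The phase \<open>z ^ 4 - 32 * \<i> * z - 24\<close> on the line \<open>z = x + \<i>\<close>. The factor \<open>32\<close> places the saddle
  points at \<open>x = \<plusminus> sqrt 3\<close> on this line, and \<open>24\<close> is the real part there.
\<close>

definition quartic_phase :: "real \<Rightarrow> complex" where
  "quartic_phase x = of_real ((x\<^sup>2 - 3)\<^sup>2) + \<i> * of_real (4 * x ^ 3 - 36 * x)"

lemma integral_exp_quartic_eq_phase:
  assumes "L > 0"
  shows "(LINT x|lborel. exp (\<i> * of_real (32 * L * x) - of_real (L * x ^ 4)))
       = of_real (exp (- 24 * L)) * (LINT x|lborel. exp (- of_real L * quartic_phase x))"
proof -
  let ?f = "\<lambda>z. exp (of_real L * (\<i> * of_real 32 * z - z ^ 4 - of_real 0 * z\<^sup>2 + of_real 0))"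
  have "(LINT x|lborel. exp (\<i> * of_real (32 * L * x) - of_real (L * x ^ 4))) = (LINT x|lborel. ?f (of_real x))"
    by (intro Bochner_Integration.integral_cong refl arg_cong[where f = exp]) (simp add: algebra_simps)
  also have "\<dots> = (LINT x|lborel. ?f (of_real x + \<i>))"
    by (rule integral_exp_quartic_shift[OF assms]) auto
  also have "\<dots> = (LINT x|lborel. of_real (exp (- 24 * L)) * exp (- of_real L * quartic_phase x))"
  proof (rule Bochner_Integration.integral_cong[OF refl])
    fix x :: real
    have "of_real L * (\<i> * of_real 32 * (of_real x + \<i>) - (of_real x + \<i>) ^ 4 - of_real 0 * (of_real x + \<i>)\<^sup>2 + of_real 0)
        = of_real (- 24 * L) + - of_real L * quartic_phase x"
      by (simp add: quartic_phase_def complex_eq_iff power2_eq_square power4_eq_xxxx power3_eq_cube algebra_simps)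
    then show "?f (of_real x + \<i>) = of_real (exp (- 24 * L)) * exp (- of_real L * quartic_phase x)"
      by (simp only: exp_add exp_of_real)
  qed
  finally show ?thesis by simp
qed

text \<open>
  The coefficient \<open>12 * (1 + \<i> * \<sigma> * sqrt 3)\<close> equals \<open>18 * (1 + \<i> * \<sigma> / sqrt 3)\<^sup>2\<close>, so the
  integral is a Gaussian along a line of slope \<open>\<sigma> / sqrt 3\<close>; the angle \<open>pi / 6\<close> of this line
  is the phase shift in the cosine of the final formula.
\<close>

lemma gaussian_integral_quartic_saddle:
  fixes \<sigma> :: real
  assumes \<sigma>: "\<sigma> = 1 \<or> \<sigma> = -1"
  shows "(LINT y|lborel. exp (- (of_real (12 * y\<^sup>2) * (1 + \<i> * of_real (\<sigma> * sqrt 3)))))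
       = of_real (sqrt (pi / 24)) * cis (- \<sigma> * pi / 6)"
proof -
  define b where "b = \<sigma> / sqrt 3"
  have b2: "b * b = 1 / 3" and s3: "sqrt 3 * sqrt 3 = 3" and bs: "b * 3 = \<sigma> * sqrt 3"
    using \<sigma> by (auto simp: b_def field_simps)
  have b1: "\<bar>b\<bar> < 1"
    using b2 by (simp add: abs_square_less_1[symmetric] power2_eq_square)
  have "(LINT y|lborel. exp (- (of_real (12 * y\<^sup>2) * (1 + \<i> * of_real (\<sigma> * sqrt 3)))))
      = (LINT y|lborel. exp (- of_real 18 * (of_real y + \<i> * of_real (0 + b * y))\<^sup>2))"
  proof (intro Bochner_Integration.integral_cong refl arg_cong[where f = exp])
    fix y :: real
    have "b * y * (b * y) = y * y / 3"
      using b2 by (metis mult.commute mult.left_commute times_divide_eq_right mult.right_neutral)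
    then show "- (of_real (12 * y\<^sup>2) * (1 + \<i> * of_real (\<sigma> * sqrt 3)))
        = - of_real 18 * (of_real y + \<i> * of_real (0 + b * y))\<^sup>2"
      by (simp add: complex_eq_iff power2_eq_square algebra_simps bs[symmetric])
  qed
  also have "\<dots> = of_real (sqrt (pi / 18)) / (1 + \<i> * of_real b)"
    using gaussian_line_integral[of 18 b 0] b1 by (subst eq_divide_eq) (auto simp: complex_eq_iff mult.commute)
  also have "\<dots> = of_real (sqrt (pi / 24)) * cis (- \<sigma> * pi / 6)"
  proof -
    have c: "cis (- \<sigma> * pi / 6) = Complex (sqrt 3 / 2) (- \<sigma> / 2)"
      using \<sigma> by (auto simp: cis.code cos_30 sin_30)
    have "sqrt (pi / 24) * sqrt 4 = sqrt (pi / 18) * sqrt 3"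
      unfolding real_sqrt_mult[symmetric] by simp
    then have e: "sqrt (pi / 24) * 2 = sqrt (pi / 18) * sqrt 3"
      by simp
    have "2 * (sqrt 3 * sqrt (pi / 24)) = sqrt 3 * (sqrt (pi / 24) * 2)"
      by simp
    also have "\<dots> = sqrt 3 * sqrt 3 * sqrt (pi / 18)"
      by (subst e) (simp only: mult_ac)
    also have "sqrt 3 * sqrt 3 = (3 :: real)"
      by simp
    finally have e3: "2 * (sqrt 3 * sqrt (pi / 24)) = 3 * sqrt (pi / 18)" .
    have "of_real (sqrt (pi / 24)) * cis (- \<sigma> * pi / 6) * (1 + \<i> * of_real b) = of_real (sqrt (pi / 18))"
      using \<sigma> e e3 unfolding c b_def
      by (auto simp: complex_eq_iff field_simps)
    moreover have "1 + \<i> * of_real b \<noteq> 0"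
      by (simp add: complex_eq_iff)
    ultimately show ?thesis
      by (simp add: field_simps)
  qed
  finally show ?thesis .
qed

text \<open>
  Here \<open>(x\<^sup>2 - 3)\<^sup>2 = (x - \<sigma> * sqrt 3)\<^sup>2 * (x + \<sigma> * sqrt 3)\<^sup>2\<close>, and the second factor is at
  least \<open>3\<close> on the half-line around \<open>\<sigma> * sqrt 3\<close>. The added constant cancels the imaginary value
  of the phase at the saddle point.
\<close>

lemma quartic_saddle_contribution:
  fixes \<sigma> :: real and S :: "real set"
  assumes \<sigma>: "\<sigma> = 1 \<or> \<sigma> = -1"
    and [measurable]: "S \<in> sets borel" and int: "\<sigma> * sqrt 3 \<in> interior S" and S: "\<And>x. x \<in> S \<Longrightarrow> \<sigma> * x \<ge> 0"
  shows "((\<lambda>k. of_real k * (LINT x:S|lborel. exp (- of_real (k\<^sup>2) * (quartic_phase x + \<i> * of_real (24 * \<sigma> * sqrt 3)))))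
     \<longlongrightarrow> of_real (sqrt (pi / 24)) * cis (- \<sigma> * pi / 6)) at_top"
proof -
  let ?\<Psi> = "\<lambda>x. quartic_phase x + \<i> * of_real (24 * \<sigma> * sqrt 3)"
  let ?q = "\<lambda>y::real. of_real (12 * y\<^sup>2) * (1 + \<i> * of_real (\<sigma> * sqrt 3))"
  have \<sigma>2: "\<sigma> * \<sigma> = 1" using \<sigma> by auto
  have "((\<lambda>k. of_real (k ^ DIM(real)) * (LINT x:S|lborel. exp (- of_real (k\<^sup>2) * ?\<Psi> x)))
           \<longlongrightarrow> (LINT y|lborel. exp (- ?q y))) at_top"
  proof (rule laplace_complex_phase[where c = 3, OF _ _ _ int])
    show "integrable lborel (\<lambda>y::real. exp (- 3 * (norm y)\<^sup>2))"
      using integrable_gaussian[of 3] by simp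
    fix x assume "x \<in> S"
    have "(\<sigma> * sqrt 3)\<^sup>2 = 3" using \<sigma>2 by (simp add: power2_eq_square algebra_simps)
    have "x\<^sup>2 - 3 = (x - \<sigma> * sqrt 3) * (x + \<sigma> * sqrt 3)"
      using \<open>(\<sigma> * sqrt 3)\<^sup>2 = 3\<close> by (simp add: power2_eq_square algebra_simps)
    then have "(x\<^sup>2 - 3)\<^sup>2 = (x - \<sigma> * sqrt 3)\<^sup>2 * (x + \<sigma> * sqrt 3)\<^sup>2"
      by (simp add: power_mult_distrib)
    also have "\<dots> \<ge> (x - \<sigma> * sqrt 3)\<^sup>2 * 3"
    proof (rule mult_left_mono)
      have "0 \<le> (\<sigma> * x) * (2 * sqrt 3)" using S[OF \<open>x \<in> S\<close>] by simp
      then have "(x + \<sigma> * sqrt 3)\<^sup>2 \<ge> x\<^sup>2 + (\<sigma> * sqrt 3)\<^sup>2"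
        by (simp add: power2_eq_square algebra_simps)
      then show "3 \<le> (x + \<sigma> * sqrt 3)\<^sup>2"
        using \<open>(\<sigma> * sqrt 3)\<^sup>2 = 3\<close> zero_le_power2[of x] by linarith
    qed auto
    finally show "3 * (norm (x - \<sigma> * sqrt 3))\<^sup>2 \<le> Re (?\<Psi> x)"
      by (simp add: quartic_phase_def mult.commute)
  next
    fix y :: real
    let ?g = "\<lambda>k. ?q y + of_real (y ^ 3) * (of_real (4 * \<sigma> * sqrt 3) + 4 * \<i>) * of_real (1 / k) + of_real (y ^ 4) * of_real ((1 / k)\<^sup>2)"
    have "(?g \<longlongrightarrow> ?q y + of_real (y ^ 3) * (of_real (4 * \<sigma> * sqrt 3) + 4 * \<i>) * of_real 0 + of_real (y ^ 4) * of_real (0\<^sup>2)) at_top"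
      by (intro tendsto_add tendsto_mult tendsto_const tendsto_of_real tendsto_power
            tendsto_divide_0[OF tendsto_const] filterlim_at_top_imp_at_infinity filterlim_ident)
    then have "(?g \<longlongrightarrow> ?q y) at_top" by simp
    moreover have "\<forall>\<^sub>F k in at_top. ?g k = of_real (k\<^sup>2) * ?\<Psi> (\<sigma> * sqrt 3 + (1 / k) *\<^sub>R y)"
      using eventually_gt_at_top[of 0]
    proof eventually_elim
      case (elim k)
      define h where "h = y / k"
      have y: "y = h * k" using elim by (simp add: h_def)
      have "?\<Psi> (\<sigma> * sqrt 3 + h) = of_real (h\<^sup>2) * (12 * (1 + \<i> * of_real (\<sigma> * sqrt 3)) 
             + (of_real (4 * \<sigma> * sqrt 3) + 4 * \<i>) * of_real h + of_real (h\<^sup>2))"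
        using \<sigma> by (auto simp: quartic_phase_def complex_eq_iff power2_eq_square power3_eq_cube algebra_simps)
      then show ?case
        unfolding y using elim 
        by (simp add: field_simps power2_eq_square power3_eq_cube power4_eq_xxxx)
    qed
    ultimately show "((\<lambda>k. of_real (k\<^sup>2) * ?\<Psi> (\<sigma> * sqrt 3 + (1 / k) *\<^sub>R y)) \<longlongrightarrow> ?q y) at_top"
      by (rule Lim_transform_eventually)
  qed (auto simp: quartic_phase_def)
  then show ?thesis
    by (simp add: gaussian_integral_quartic_saddle[OF \<sigma>] del: of_real_mult of_real_power)
qed

text \<open>
  Splitting the line at \<open>0\<close> separates the two saddle points. Their contributions have
  asymptotically equal moduli and opposite phases \<open>\<plusminus> (24 * sqrt 3 * k\<^sup>2 - pi / 6)\<close>, hence the cosine.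
  Since the cosine has zeros, the error is additive.
\<close>

lemma quartic_1d_asymptotics:
  "((\<lambda>k. of_real (k * exp (24 * k\<^sup>2)) *
        (LINT x|lborel. exp (\<i> * of_real (32 * k\<^sup>2 * x) - of_real (k\<^sup>2 * x ^ 4)))
      - of_real (sqrt (pi / 6) * cos (24 * sqrt 3 * k\<^sup>2 - pi / 6))) \<longlongrightarrow> (0 :: complex)) at_top"
proof -
  define A where "A \<sigma> S k = of_real k * (LINT x:S|lborel. exp (- of_real (k\<^sup>2) * (quartic_phase x + \<i> * of_real (24 * \<sigma> * sqrt 3))))"
    for \<sigma> k :: real and S :: "real set"
  define g where "g \<sigma> = of_real (sqrt (pi / 24)) * cis (- \<sigma> * pi / 6)" for \<sigma> :: real
  have "(A 1 {0<..} \<longlongrightarrow> g 1) at_top"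
    unfolding A_def[abs_def] g_def by (rule quartic_saddle_contribution) (auto simp: interior_open)
  then have A1: "((\<lambda>k. norm (A 1 {0<..} k - g 1)) \<longlongrightarrow> 0) at_top"
    using LIM_zero tendsto_norm_zero by blast
  have "(A (-1) {..0} \<longlongrightarrow> g (-1)) at_top"
    unfolding A_def[abs_def] g_def
  proof (rule quartic_saddle_contribution)
    have "- 1 * sqrt 3 \<in> {..<0}" by simp
    also have "{..<0} \<subseteq> interior {..0::real}" by (intro interior_maximal) auto
    finally show "- 1 * sqrt 3 \<in> interior {..0}" .
  qed auto
  then have A2: "((\<lambda>k. norm (A (-1) {..0} k - g (-1))) \<longlongrightarrow> 0) at_top"
    using LIM_zero tendsto_norm_zero by blast
  show ?thesis
  proof (rule Lim_null_comparison)
    show "((\<lambda>k. norm (A 1 {0<..} k - g 1) + norm (A (-1) {..0} k - g (-1))) \<longlongrightarrow> 0) at_top"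
      using tendsto_add[OF A1 A2] by simp
    show "\<forall>\<^sub>F k in at_top. norm (of_real (k * exp (24 * k\<^sup>2)) *
        (LINT x|lborel. exp (\<i> * of_real (32 * k\<^sup>2 * x) - of_real (k\<^sup>2 * x ^ 4)))
      - complex_of_real (sqrt (pi / 6) * cos (24 * sqrt 3 * k\<^sup>2 - pi / 6)))
      \<le> norm (A 1 {0<..} k - g 1) + norm (A (-1) {..0} k - g (-1))"
      using eventually_gt_at_top[of 0]
    proof eventually_elim
      case (elim k)
      then have k: "k\<^sup>2 > 0" by simp
      let ?f = "\<lambda>x. exp (- of_real (k\<^sup>2) * quartic_phase x)"
      let ?\<theta> = "24 * sqrt 3 * k\<^sup>2"
      have int: "integrable lborel ?f"
      proof (rule integrable_bounded_by_gaussian[OF _ k, where C = "exp (13 / 4 * k\<^sup>2)"])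
        show "continuous_on UNIV ?f"
          unfolding quartic_phase_def by (intro continuous_intros)
        fix x :: real
        have "0 \<le> (x\<^sup>2 - 7 / 2)\<^sup>2" by simp
        then have "x\<^sup>2 - 13 / 4 \<le> (x\<^sup>2 - 3)\<^sup>2"
          by (simp add: power2_eq_square algebra_simps)
        then have "k\<^sup>2 * (x\<^sup>2 - 13 / 4) \<le> k\<^sup>2 * (x\<^sup>2 - 3)\<^sup>2"
          by (intro mult_left_mono) auto
        then show "norm (?f x) \<le> exp (13 / 4 * k\<^sup>2) * exp (- k\<^sup>2 * x\<^sup>2)"
          unfolding exp_add[symmetric]
          by (simp add: norm_exp_eq_Re quartic_phase_def right_diff_distrib mult.commute flip: of_real_power)
      qed
      have part: "of_real k * (LINT x:S|lborel. ?f x) = cis (\<sigma> * ?\<theta>) * A \<sigma> S k" for \<sigma> S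
      proof -
        have "?f x = cis (\<sigma> * ?\<theta>) * exp (- of_real (k\<^sup>2) * (quartic_phase x + \<i> * of_real (24 * \<sigma> * sqrt 3)))" for x
          unfolding cis_conv_exp exp_add[symmetric] by (intro arg_cong[where f = exp]) (simp add: algebra_simps)
        then show ?thesis
          by (simp add: A_def)
      qed
      have "of_real (k * exp (24 * k\<^sup>2)) *
          (LINT x|lborel. exp (\<i> * of_real (32 * k\<^sup>2 * x) - of_real (k\<^sup>2 * x ^ 4)))
          = of_real (k * exp (24 * k\<^sup>2) * exp (- 24 * k\<^sup>2)) * (LINT x|lborel. ?f x)"
        unfolding integral_exp_quartic_eq_phase[OF k] by (simp add: mult.assoc)
      also have "k * exp (24 * k\<^sup>2) * exp (- 24 * k\<^sup>2) = k"
        by (simp add: mult.assoc flip: exp_add)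
      also have "(LINT x|lborel. ?f x) = (LINT x:{0<..}|lborel. ?f x) + (LINT x:{..0}|lborel. ?f x)"
      proof -
        have "(LINT x:{0<..} \<union> {..0}|lborel. ?f x) = (LINT x:{0<..}|lborel. ?f x) + (LINT x:{..0}|lborel. ?f x)"
          using int by (intro set_integral_Un) (auto simp: set_integrable_def intro: integrable_mult_indicator)
        moreover have "{0<..} \<union> {..0} = (UNIV :: real set)" by auto
        ultimately show ?thesis by (simp add: set_lebesgue_integral_def)
      qed
      also have "of_real k * \<dots> = cis ?\<theta> * A 1 {0<..} k + cis (- ?\<theta>) * A (-1) {..0} k"
        unfolding distrib_left part[of "{0<..}" 1] part[of "{..0}" "-1"] by simp
      finally have J: "of_real (k * exp (24 * k\<^sup>2)) *
          (LINT x|lborel. exp (\<i> * of_real (32 * k\<^sup>2 * x) - of_real (k\<^sup>2 * x ^ 4)))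
          = cis ?\<theta> * A 1 {0<..} k + cis (- ?\<theta>) * A (-1) {..0} k" .
      have G: "of_real (sqrt (pi / 6) * cos (?\<theta> - pi / 6)) = cis ?\<theta> * g 1 + cis (- ?\<theta>) * g (-1)"
      proof -
        have "sqrt (pi / 24) * sqrt 4 = sqrt (pi / 6)"
          unfolding real_sqrt_mult[symmetric] by simp
        then have e: "sqrt (pi / 6) = 2 * sqrt (pi / 24)" by simp
        have "cis ?\<theta> * g 1 + cis (- ?\<theta>) * g (-1)
            = of_real (sqrt (pi / 24)) * (cis (?\<theta> - pi / 6) + cis (- (?\<theta> - pi / 6)))"
        proof -
          have "cis (?\<theta> - pi / 6) = cis ?\<theta> * cis (- (pi / 6))"
            and "cis (- (?\<theta> - pi / 6)) = cis (- ?\<theta>) * cis (pi / 6)"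
            by (simp_all add: cis_mult)
          then show ?thesis
            unfolding g_def by (simp only:) (simp add: algebra_simps)
        qed
        also have "cis (?\<theta> - pi / 6) + cis (- (?\<theta> - pi / 6)) = of_real (2 * cos (?\<theta> - pi / 6))"
        proof -
          have "cis w + cis (- w) = of_real (2 * cos w)" for w
            by (simp add: complex_eq_iff)
          then show ?thesis .
        qed
        finally show ?thesis unfolding e by simp
      qed
      have "norm (of_real (k * exp (24 * k\<^sup>2)) *
          (LINT x|lborel. exp (\<i> * of_real (32 * k\<^sup>2 * x) - of_real (k\<^sup>2 * x ^ 4)))
          - complex_of_real (sqrt (pi / 6) * cos (?\<theta> - pi / 6)))
          = norm (cis ?\<theta> * (A 1 {0<..} k - g 1) + cis (- ?\<theta>) * (A (-1) {..0} k - g (-1)))"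
        unfolding J G by (simp add: algebra_simps)
      also have "\<dots> \<le> norm (cis ?\<theta> * (A 1 {0<..} k - g 1)) + norm (cis (- ?\<theta>) * (A (-1) {..0} k - g (-1)))"
        by (rule norm_triangle_ineq)
      finally show ?case by (simp add: norm_mult)
    qed
  qed
qed

lemma powr_cube_root:
  fixes x :: real
  assumes "x > 0"
  shows "(x powr (1/3)) ^ 3 = x" "x powr (-1/3) = 1 / x powr (1/3)" "x powr (-2/3) = 1 / (x powr (1/3))\<^sup>2"
    "x powr (4/3) = (x powr (1/3)) ^ 4"
  using assms
  by (simp_all add: powr_powr powr_minus_divide flip: powr_realpow)

lemma heat_kernel_0_diagonal:
  assumes "t > 0"
  shows "heat_kernel 0 (s, s) t = of_real (1 / (2 * pi)\<^sup>2) *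
    (LINT u|lborel. exp (\<i> * of_real (s * u) - of_real (t * u ^ 4)))\<^sup>2"
proof -
  let ?g = "\<lambda>u. exp (\<i> * complex_of_real (s * u) - of_real (t * u ^ 4))"
  have e: "exp (\<i> * of_real ((x, y) \<bullet> (s, s)) - of_real (t * quartic_symbol 0 (x, y))) = ?g x * ?g y" for x y
    unfolding exp_add[symmetric] by (intro arg_cong[where f = exp]) (simp add: quartic_symbol_def algebra_simps)
  show ?thesis
    unfolding heat_kernel_def
    by (subst integral_lborel_fst[OF integrable_heat_integrand[OF _ assms]])
       (simp_all only: e, simp_all add: power2_eq_square)
qed

text \<open>
  The kernel is \<open>\<mu>\<^sup>2 / (2 * pi)\<^sup>2\<close> times the square of the normalised one-dimensional integral, for
  \<open>\<mu> ^ 3 = s / (32 * t)\<close> and \<open>k\<^sup>2 = t * \<mu> ^ 4\<close>. Squaring a cosine with an additive null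
  error gives half of \<open>1 + cos\<close> of the doubled angle with a null error. All fractional powers are
  expressed by the cube roots \<open>S\<close>, \<open>T\<close>, \<open>F\<close> of \<open>s\<close>, \<open>t\<close>, \<open>4\<close>, so that the constants can be
  compared by rational arithmetic.
\<close>

lemma diagonal_beta_0_asymptotics:
  fixes s :: real
  assumes s: "s > 0"
  shows "\<exists>e. (e \<longlongrightarrow> 0) (at_right 0) \<and> (\<forall>\<^sub>F t in at_right 0.
          heat_kernel 0 (s, s) t =
          complex_of_real (
            1 / (3 * 4 powr (1/3) * pi) * s powr (-2/3) * t powr (-1/3)
            * exp (- (3 / 4 powr (4/3)) * (s powr (4/3) / t powr (1/3))))
          * (complex_of_real
               (1 + cos (3 * sqrt 3 / 4 powr (4/3) * (s powr (4/3) / t powr (1/3)) - pi/3))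
             + e t))"
proof -
  define S where "S = s powr (1/3)"
  define F where "F = (4 :: real) powr (1/3)"
  have S: "S > 0" "S ^ 3 = s" and F: "F > 0" "F ^ 3 = 4"
    using s powr_cube_root(1)[of s] powr_cube_root(1)[of 4] by (simp_all add: S_def F_def)
  have F4: "(4 :: real) powr (4/3) = 4 * F"
    using F(2) by (simp add: powr_cube_root(4) F_def[symmetric] power4_eq_xxxx power3_eq_cube)
  define k where "k t = sqrt (S ^ 4 / (64 * F)) / sqrt (t powr (1/3))" for t :: real
  define J where "J k = (LINT x|lborel. exp (\<i> * of_real (32 * k\<^sup>2 * x) - of_real (k\<^sup>2 * x ^ 4)))" for k :: real
  define d where "d k = of_real (k * exp (24 * k\<^sup>2)) * J k - of_real (sqrt (pi / 6) * cos (24 * sqrt 3 * k\<^sup>2 - pi / 6))" for k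
  define e where "e k = of_real (12 / pi) * (of_real (2 * sqrt (pi / 6) * cos (24 * sqrt 3 * k\<^sup>2 - pi / 6)) * d k + (d k)\<^sup>2)" for k
  have k_lim: "filterlim k at_top (at_right 0)"
    unfolding k_def[abs_def] using S F by real_asymp
  have d: "(d \<longlongrightarrow> 0) at_top"
    unfolding d_def[abs_def] J_def by (rule quartic_1d_asymptotics)
  have "(e \<longlongrightarrow> 0) at_top"
  proof (rule Lim_null_comparison)
    show "((\<lambda>k. 12 / pi * (2 * sqrt (pi / 6) * norm (d k) + (norm (d k))\<^sup>2)) \<longlongrightarrow> 0) at_top"
      using d by (auto intro!: tendsto_eq_intros)
    show "\<forall>\<^sub>F k in at_top. norm (e k) \<le> 12 / pi * (2 * sqrt (pi / 6) * norm (d k) + (norm (d k))\<^sup>2)"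
    proof (intro always_eventually allI)
      fix k
      have "norm (of_real (2 * sqrt (pi / 6) * cos (24 * sqrt 3 * k\<^sup>2 - pi / 6)) * d k + (d k)\<^sup>2)
          \<le> norm (of_real (2 * sqrt (pi / 6) * cos (24 * sqrt 3 * k\<^sup>2 - pi / 6)) * d k) + norm ((d k)\<^sup>2)"
        by (rule norm_triangle_ineq)
      also have "norm (of_real (2 * sqrt (pi / 6) * cos (24 * sqrt 3 * k\<^sup>2 - pi / 6)) * d k)
          = 2 * sqrt (pi / 6) * norm (d k) * \<bar>cos (24 * sqrt 3 * k\<^sup>2 - pi / 6)\<bar>"
        by (simp add: norm_mult abs_mult del: of_real_mult)
      also have "\<dots> \<le> 2 * sqrt (pi / 6) * norm (d k) * 1"
        by (intro mult_left_mono abs_cos_le_one) auto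
      finally have "norm (of_real (2 * sqrt (pi / 6) * cos (24 * sqrt 3 * k\<^sup>2 - pi / 6)) * d k + (d k)\<^sup>2)
          \<le> 2 * sqrt (pi / 6) * norm (d k) + (norm (d k))\<^sup>2"
        by (simp add: norm_power)
      then show "norm (e k) \<le> 12 / pi * (2 * sqrt (pi / 6) * norm (d k) + (norm (d k))\<^sup>2)"
        unfolding e_def norm_mult[of "of_real (12 / pi)"] norm_of_real
        by (intro mult_mono) auto
    qed
  qed
  then have "((\<lambda>t. e (k t)) \<longlongrightarrow> 0) (at_right 0)"
    using filterlim_compose k_lim by blast
  moreover have "\<forall>\<^sub>F t in at_right 0.
          heat_kernel 0 (s, s) t =
          complex_of_real (
            1 / (3 * 4 powr (1/3) * pi) * s powr (-2/3) * t powr (-1/3)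
            * exp (- (3 / 4 powr (4/3)) * (s powr (4/3) / t powr (1/3))))
          * (complex_of_real
               (1 + cos (3 * sqrt 3 / 4 powr (4/3) * (s powr (4/3) / t powr (1/3)) - pi/3))
             + e (k t))"
    using eventually_at_right_less[of 0]
  proof eventually_elim
    case (elim t)
    define T where "T = t powr (1/3)"
    have T: "T > 0" "T ^ 3 = t" using elim powr_cube_root(1)[of t] by (simp_all add: T_def)
    define \<mu> where "\<mu> = S / (2 * F * T)"
    have \<mu>: "\<mu> > 0" using S F T by (simp add: \<mu>_def)
    define K where "K = k t"
    have K: "K > 0" "K\<^sup>2 = S ^ 4 / (64 * F * T)"
      using S F T by (simp_all add: K_def k_def T_def[symmetric] power_divide)
    have tmu: "t * \<mu> ^ 4 = K\<^sup>2"
    proof -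
      have "t * \<mu> ^ 4 = S ^ 4 / (16 * F ^ 3 * F * T)"
        using T S F unfolding \<mu>_def T(2)[symmetric] by (simp add: field_simps power3_eq_cube power4_eq_xxxx)
      then show ?thesis unfolding F K by simp
    qed
    have smu: "s * \<mu> = 32 * K\<^sup>2"
      using T S F unfolding \<mu>_def S(2)[symmetric] K(2) by (simp add: field_simps power3_eq_cube power4_eq_xxxx)
    have "(LINT u|lborel. exp (\<i> * of_real (s * u) - of_real (t * u ^ 4)))
        = \<bar>\<mu>\<bar> *\<^sub>R (LINT x|lborel. exp (\<i> * of_real (s * (0 + \<mu> * x)) - of_real (t * (0 + \<mu> * x) ^ 4)))"
      by (rule lborel_integral_real_affine) (use \<mu> in auto)
    also have "(\<lambda>x. exp (\<i> * of_real (s * (0 + \<mu> * x)) - of_real (t * (0 + \<mu> * x) ^ 4)))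
        = (\<lambda>x. exp (\<i> * of_real (32 * K\<^sup>2 * x) - of_real (K\<^sup>2 * x ^ 4)))"
    proof -
      have "s * (0 + \<mu> * x) = 32 * K\<^sup>2 * x" for x
        unfolding smu[symmetric] by simp
      moreover have "t * (0 + \<mu> * x) ^ 4 = K\<^sup>2 * x ^ 4" for x
        unfolding tmu[symmetric] by (simp add: power_mult_distrib)
      ultimately show ?thesis by (simp only:)
    qed
    finally have "(LINT u|lborel. exp (\<i> * of_real (s * u) - of_real (t * u ^ 4))) = of_real \<mu> * J K"
      using \<mu> by (simp add: J_def scaleR_conv_of_real)
    then have G: "heat_kernel 0 (s, s) t = of_real (\<mu>\<^sup>2 / (2 * pi)\<^sup>2) * (J K)\<^sup>2"
      unfolding heat_kernel_0_diagonal[OF elim] by (simp add: power_mult_distrib)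
    define c where "c = cos (24 * sqrt 3 * K\<^sup>2 - pi / 6)"
    have J: "J K = of_real (exp (- 24 * K\<^sup>2) / K) * (of_real (sqrt (pi / 6) * c) + d K)"
      using K(1) by (simp add: d_def c_def exp_minus field_simps flip: exp_of_real)
    have sq: "(of_real (sqrt (pi / 6) * c) + d K)\<^sup>2 = of_real (pi / 12) * (of_real (2 * c\<^sup>2) + e K)"
    proof -
      have "(of_real (sqrt (pi / 6) * c) + d K)\<^sup>2 = of_real ((sqrt (pi / 6) * c)\<^sup>2) + (of_real (2 * sqrt (pi / 6) * c) * d K + (d K)\<^sup>2)"
        by (simp add: power2_sum)
      also have "(sqrt (pi / 6) * c)\<^sup>2 = pi / 12 * (2 * c\<^sup>2)"
        by (simp add: power_mult_distrib)
      also have "of_real (2 * sqrt (pi / 6) * c) * d K + (d K)\<^sup>2 = of_real (pi / 12) * e K"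
        by (simp add: e_def c_def)
      finally show ?thesis by (simp add: distrib_left)
    qed
    have c2: "2 * c\<^sup>2 = 1 + cos (3 * sqrt 3 / (4 * F) * (S ^ 4 / T) - pi/3)"
    proof -
      have "1 + cos (2 * (24 * sqrt 3 * K\<^sup>2 - pi / 6)) = 2 * c\<^sup>2"
        unfolding cos_double_cos c_def by simp
      also have "2 * (24 * sqrt 3 * K\<^sup>2 - pi / 6) = 3 * sqrt 3 / (4 * F) * (S ^ 4 / T) - pi/3"
        using F T unfolding K(2) by (simp add: field_simps)
      finally show ?thesis ..
    qed
    have "heat_kernel 0 (s, s) t = of_real (\<mu>\<^sup>2 / (2 * pi)\<^sup>2 * (exp (- 24 * K\<^sup>2) / K)\<^sup>2 * (pi / 12)) * (of_real (2 * c\<^sup>2) + e K)"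
      unfolding G J power_mult_distrib sq by simp
    also have "\<mu>\<^sup>2 / (2 * pi)\<^sup>2 * (exp (- 24 * K\<^sup>2) / K)\<^sup>2 * (pi / 12)
      = 1 / (3 * F * pi) * (1 / S\<^sup>2) * (1 / T) * exp (- (3 / (4 * F)) * (S ^ 4 / T))"
    proof -
      have "(exp (- 24 * K\<^sup>2))\<^sup>2 = exp (- 48 * K\<^sup>2)"
        by (simp add: power2_eq_square flip: exp_add)
      also have "- 48 * K\<^sup>2 = - (3 / (4 * F)) * (S ^ 4 / T)"
        using F T unfolding K(2) by (simp add: field_simps)
      finally have e: "(exp (- 24 * K\<^sup>2) / K)\<^sup>2 = exp (- (3 / (4 * F)) * (S ^ 4 / T)) / (S ^ 4 / (64 * F * T))"
        unfolding power_divide K(2) by simp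
      have c: "\<mu>\<^sup>2 / (2 * pi)\<^sup>2 / (S ^ 4 / (64 * F * T)) * (pi / 12) = 1 / (3 * F * pi) * (1 / S\<^sup>2) * (1 / T)"
        using S F T unfolding \<mu>_def by (simp add: field_simps power2_eq_square power4_eq_xxxx)
      have "m * (x / z) * n = (m / z * n) * x" for m n x z :: real
        by simp
      then show ?thesis unfolding e by (simp only: c)
    qed
    finally show ?case
      unfolding c2 K_def by (simp only: powr_cube_root[OF elim] powr_cube_root[OF s] F4 flip: F_def S_def T_def)
  qed
  ultimately show ?thesis by blast
qed

text \<open>
  The rotation takes \<open>\<beta> = 0\<close> to \<open>\<beta> = 3\<close> and divides the time by \<open>8\<close>.
\<close>

lemma axis_beta_3_asymptotics:
  fixes s :: real
  assumes s: "s > 0"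
  shows "\<exists>e. (e \<longlongrightarrow> 0) (at_right 0) \<and> (\<forall>\<^sub>F t in at_right 0.
          heat_kernel 3 (s, 0) t =
          complex_of_real (
            1 / (3 * 4 powr (1/3) * pi) * s powr (-2/3) * t powr (-1/3)
            * exp (- (3 / (8 * 4 powr (1/3))) * (s powr (4/3) / t powr (1/3))))
          * (complex_of_real
               (1 + cos (3 * sqrt 3 / (8 * 4 powr (1/3)) * (s powr (4/3) / t powr (1/3)) - pi/3))
             + e t))"
proof -
  obtain e where e: "(e \<longlongrightarrow> 0) (at_right 0)" and
    ev: "\<forall>\<^sub>F t in at_right 0. heat_kernel 0 (s, s) t =
          complex_of_real (
            1 / (3 * 4 powr (1/3) * pi) * s powr (-2/3) * t powr (-1/3)
            * exp (- (3 / 4 powr (4/3)) * (s powr (4/3) / t powr (1/3))))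
          * (complex_of_real
               (1 + cos (3 * sqrt 3 / 4 powr (4/3) * (s powr (4/3) / t powr (1/3)) - pi/3))
             + e t)"
    using diagonal_beta_0_asymptotics[OF s] by blast
  have lim: "filterlim (\<lambda>t::real. 8 * t) (at_right 0) (at_right 0)"
    by real_asymp
  have "\<forall>\<^sub>F t in at_right 0.
          heat_kernel 3 (s, 0) t =
          complex_of_real (
            1 / (3 * 4 powr (1/3) * pi) * s powr (-2/3) * t powr (-1/3)
            * exp (- (3 / (8 * 4 powr (1/3))) * (s powr (4/3) / t powr (1/3))))
          * (complex_of_real
               (1 + cos (3 * sqrt 3 / (8 * 4 powr (1/3)) * (s powr (4/3) / t powr (1/3)) - pi/3))
             + e (8 * t))"
    using eventually_at_right_less[of 0] eventually_compose_filterlim[OF ev lim]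
  proof eventually_elim
    case (elim t)
    have "(8 :: real) powr (1/3) = (2 powr 3) powr (1/3)" by simp
    then have "(8 :: real) powr (1/3) = 2" unfolding powr_powr by simp
    then have t8: "(8 * t) powr (1/3) = 2 * t powr (1/3)"
      using elim(1) by (simp add: powr_mult)
    have t8': "(8 * t) powr (-1/3) = 1 / 2 * t powr (-1/3)"
      using elim(1) powr_cube_root(2)[of "8 * t"] powr_cube_root(2)[of t] by (simp add: t8)
    have F4: "(4 :: real) powr (4/3) = 4 * 4 powr (1/3)"
      using powr_cube_root(1)[of 4] by (simp add: powr_cube_root(4) power4_eq_xxxx power3_eq_cube)
    have half: "c / (4 * 4 powr (1/3)) * (s powr (4/3) / (2 * t powr (1/3)))
        = c / (8 * 4 powr (1/3)) * (s powr (4/3) / t powr (1/3))" for c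
      by simp
    have double: "of_real 2 * (of_real (A * (1 / 2 * T) * X) * Y) = of_real (A * T * X) * Y"
      for A T X :: real and Y :: complex
      by simp
    have "heat_kernel 3 (s, 0) t = of_real 2 * heat_kernel 0 (s, s) (8 * t)"
      using heat_kernel_rotation[of 0 "8 * t" s] elim(1) by (simp add: mult.commute)
    also have "\<dots> = complex_of_real (
            1 / (3 * 4 powr (1/3) * pi) * s powr (-2/3) * t powr (-1/3)
            * exp (- (3 / (8 * 4 powr (1/3))) * (s powr (4/3) / t powr (1/3))))
          * (complex_of_real
               (1 + cos (3 * sqrt 3 / (8 * 4 powr (1/3)) * (s powr (4/3) / t powr (1/3)) - pi/3))
             + e (8 * t))"
      unfolding elim(2) t8 t8' F4 minus_mult_left[symmetric] half by (rule double)
    finally show ?case .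
  qed
  moreover have "((\<lambda>t. e (8 * t)) \<longlongrightarrow> 0) (at_right 0)"
    using filterlim_compose[OF e lim] .
  ultimately show ?thesis by blast
qed

section \<open>The axis for beta > 3, and the diagonal for beta < 0\<close>
text \<open>
  For \<open>u = x + \<i>\<close> and real \<open>v\<close> this is
  \<open>u ^ 4 + 2 * \<beta> * u\<^sup>2 * v\<^sup>2 + v ^ 4 - 4 * (\<beta>\<^sup>2 - 1) * \<i> * u - 3 * (\<beta>\<^sup>2 - 1)\<close>, written in terms of
  \<open>x\<close> and \<open>W = v\<^sup>2 - \<beta>\<close>, both of which vanish at the saddle points. The factor
  \<open>4 * (\<beta>\<^sup>2 - 1)\<close> normalises the imaginary part of the saddle points to \<open>1\<close>.
\<close>

definition saddle_phase :: "real \<Rightarrow> real \<times> real \<Rightarrow> complex" where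
  "saddle_phase \<beta> z = (let x = fst z; W = (snd z)\<^sup>2 - \<beta> in
     of_real (W\<^sup>2 + 2 * \<beta> * x\<^sup>2 * W + x ^ 4 + (2 * \<beta>\<^sup>2 - 6) * x\<^sup>2)
     + \<i> * of_real (4 * \<beta> * x * W + 4 * x ^ 3))"

lemma continuous_on_saddle_phase [continuous_intros]:
  "continuous_on UNIV (saddle_phase \<beta>)"
  unfolding saddle_phase_def[abs_def] Let_def by (intro continuous_intros)

text \<open>
  With \<open>y = x\<^sup>2\<close> and \<open>w = v\<^sup>2\<close> the real part is
  \<open>(w - \<beta> + 3 * y / \<beta>)\<^sup>2 + (1 - 9 / \<beta>\<^sup>2) * y\<^sup>2 + (2 * \<beta> - 6 / \<beta>) * y * w\<close>, where both
  coefficients are positive because \<open>\<beta> > 3\<close>. It controls \<open>y\<close> linearly: for small \<open>y\<close> this comes from the last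
  term unless \<open>w\<close> is small as well, and then the first square is at least \<open>1\<close>.
\<close>

lemma saddle_phase_coercive:
  assumes "\<beta> > 3"
  shows "\<exists>c>0. \<forall>x v. c * (x\<^sup>2 + (\<bar>v\<bar> - sqrt \<beta>)\<^sup>2) \<le> Re (saddle_phase \<beta> (x, v))"
proof -
  define a where "a = 1 - 9 / \<beta>\<^sup>2"
  define b where "b = 2 * \<beta> - 6 / \<beta>"
  define c where "c = min a (min b 1)"
  have "\<beta> * \<beta> > 3 * 3" using assms by (intro mult_strict_mono) auto
  then have a: "a > 0" using assms by (simp add: a_def power2_eq_square field_simps)
  have b: "b > 0" using \<open>\<beta> * \<beta> > 3 * 3\<close> assms by (simp add: b_def field_simps)
  have c: "c > 0" "c \<le> a" "c \<le> b" "c \<le> 1" using a b by (auto simp: c_def)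
  have "c / 4 * (x\<^sup>2 + (\<bar>v\<bar> - sqrt \<beta>)\<^sup>2) \<le> Re (saddle_phase \<beta> (x, v))" for x v
  proof -
    define y where "y = x\<^sup>2"
    define w where "w = v\<^sup>2"
    define E where "E = Re (saddle_phase \<beta> (x, v))"
    have y: "y \<ge> 0" and w: "w \<ge> 0" by (auto simp: y_def w_def)
    have x4: "x ^ 4 = y\<^sup>2" by (simp add: y_def flip: power_mult)
    have E: "E = (w - \<beta> + 3 * y / \<beta>)\<^sup>2 + a * y\<^sup>2 + b * (y * w)"
      using assms by (simp add: E_def saddle_phase_def Let_def a_def b_def x4 flip: y_def w_def)
                     (simp add: power2_eq_square field_simps)
    have E1: "E \<ge> c * y"
    proof (cases "y \<ge> 1")
      case True
      have "c * y \<le> a * y\<^sup>2"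
        using c y True mult_mono[of c a y "y\<^sup>2"] a by (simp add: power2_eq_square)
      moreover have "0 \<le> b * (y * w)" using b y w by simp
      ultimately show ?thesis unfolding E using zero_le_power2[of "w - \<beta> + 3 * y / \<beta>"] by linarith
    next
      case False
      show ?thesis
      proof (cases "w \<ge> 1")
        case True
        have "c * y \<le> b * (y * w)"
          using c y True mult_mono[of c b y "y * w"] b mult_left_mono[OF True y] by simp
        moreover have "0 \<le> a * y\<^sup>2" using a by simp
        ultimately show ?thesis unfolding E using zero_le_power2[of "w - \<beta> + 3 * y / \<beta>"] by linarith
      next
        case w1: False
        have "3 * y / \<beta> \<le> 1"
          using False assms by (simp add: field_simps)
        then have "1 \<le> \<bar>w - \<beta> + 3 * y / \<beta>\<bar>" using w1 assms by linarith
        then have "1 \<le> (w - \<beta> + 3 * y / \<beta>)\<^sup>2"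
          using power_mono[of 1 "\<bar>w - \<beta> + 3 * y / \<beta>\<bar>" 2] by simp
        moreover have "c * y \<le> 1" using c y False mult_mono[of c 1 y 1] by simp
        moreover have "0 \<le> b * (y * w)" using b y w by simp
        moreover have "0 \<le> a * y\<^sup>2" using a by simp
        ultimately show ?thesis unfolding E by linarith
      qed
    qed
    have E2: "E \<ge> c / 2 * (w - \<beta>)\<^sup>2"
    proof -
      define u where "u = w - \<beta> + 3 * y / \<beta>"
      have "(w - \<beta>)\<^sup>2 \<le> 2 * u\<^sup>2 + 2 * (3 * y / \<beta>)\<^sup>2"
      proof -
        have "w - \<beta> = u - 3 * y / \<beta>" by (simp add: u_def)
        moreover have "0 \<le> (u + r)\<^sup>2 \<Longrightarrow> (u - r)\<^sup>2 \<le> 2 * u\<^sup>2 + 2 * r\<^sup>2" for r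
          by (simp add: power2_eq_square algebra_simps)
        ultimately show ?thesis by simp
      qed
      also have "(3 * y / \<beta>)\<^sup>2 \<le> y\<^sup>2"
      proof (rule power_mono)
        have "3 * y \<le> \<beta> * y" using assms y by (intro mult_right_mono) auto
        then show "3 * y / \<beta> \<le> y" using assms by (simp add: field_simps)
      qed (use assms y in auto)
      finally have "(w - \<beta>)\<^sup>2 \<le> 2 * u\<^sup>2 + 2 * y\<^sup>2" by simp
      then have "c / 2 * (w - \<beta>)\<^sup>2 \<le> c / 2 * (2 * u\<^sup>2 + 2 * y\<^sup>2)"
        using c by (intro mult_left_mono) auto
      also have "\<dots> = c * u\<^sup>2 + c * y\<^sup>2" by (simp add: algebra_simps)
      also have "c * u\<^sup>2 \<le> 1 * u\<^sup>2" using c by (intro mult_right_mono) auto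
      also have "c * y\<^sup>2 \<le> a * y\<^sup>2" using c by (intro mult_right_mono) auto
      finally have "c / 2 * (w - \<beta>)\<^sup>2 \<le> u\<^sup>2 + a * y\<^sup>2" by simp
      moreover have "0 \<le> b * (y * w)" using b y w by simp
      ultimately show ?thesis unfolding E u_def by linarith
    qed
    have "(\<bar>v\<bar> - sqrt \<beta>)\<^sup>2 \<le> (w - \<beta>)\<^sup>2"
    proof -
      have "w - \<beta> = (\<bar>v\<bar> - sqrt \<beta>) * (\<bar>v\<bar> + sqrt \<beta>)"
        using assms by (simp add: w_def algebra_simps power2_eq_square)
      then have "(w - \<beta>)\<^sup>2 = (\<bar>v\<bar> - sqrt \<beta>)\<^sup>2 * (\<bar>v\<bar> + sqrt \<beta>)\<^sup>2"
        by (simp add: power_mult_distrib)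
      moreover have "1 \<le> (\<bar>v\<bar> + sqrt \<beta>)\<^sup>2"
      proof -
        have "1 \<le> sqrt \<beta>" using assms by simp
        then have "1 \<le> \<bar>v\<bar> + sqrt \<beta>" by linarith
        then show ?thesis using power_mono[of 1 "\<bar>v\<bar> + sqrt \<beta>" 2] by simp
      qed
      ultimately show ?thesis
        using mult_left_mono[of 1 "(\<bar>v\<bar> + sqrt \<beta>)\<^sup>2" "(\<bar>v\<bar> - sqrt \<beta>)\<^sup>2"] by simp
    qed
    then have "c / 2 * (\<bar>v\<bar> - sqrt \<beta>)\<^sup>2 \<le> c / 2 * (w - \<beta>)\<^sup>2"
      using c by (intro mult_left_mono) auto
    moreover have "c * y \<ge> 0" using c y by simp
    ultimately have "c / 4 * (y + (\<bar>v\<bar> - sqrt \<beta>)\<^sup>2) \<le> E"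
      using E1 E2 unfolding distrib_left by linarith
    then show ?thesis by (simp add: E_def y_def)
  qed
  then show ?thesis using c by (intro exI[of _ "c / 4"]) auto
qed

lemma integrable_exp_saddle_phase:
  assumes \<beta>: "\<beta> > 3" and L: "L > 0"
  shows "integrable lborel (\<lambda>z. exp (- of_real L * saddle_phase \<beta> z))"
proof -
  obtain c where c: "c > 0" "\<And>x v. c * (x\<^sup>2 + (\<bar>v\<bar> - sqrt \<beta>)\<^sup>2) \<le> Re (saddle_phase \<beta> (x, v))"
    using saddle_phase_coercive[OF \<beta>] by auto
  show ?thesis
  proof (rule integrable_bounded_by_gaussian_prod[where A = "L * c / 2" and C = "exp (L * c * \<beta>)"])
    fix z :: "real \<times> real"
    obtain x v where z: "z = (x, v)" by (cases z)
    define p where "p = \<bar>v\<bar> * sqrt \<beta>"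
    have e1: "(\<bar>v\<bar> - 2 * sqrt \<beta>)\<^sup>2 = v\<^sup>2 - 4 * p + 4 * \<beta>"
      and e2: "(\<bar>v\<bar> - sqrt \<beta>)\<^sup>2 = v\<^sup>2 - 2 * p + \<beta>"
      using \<beta> by (simp_all add: power2_diff power_mult_distrib p_def)
    have "0 \<le> v\<^sup>2 - 4 * p + 4 * \<beta> + x\<^sup>2"
      unfolding e1[symmetric] by simp
    then have "(x\<^sup>2 + v\<^sup>2) / 2 - \<beta> \<le> x\<^sup>2 + (\<bar>v\<bar> - sqrt \<beta>)\<^sup>2"
      unfolding e2 by (simp add: field_simps)
    then have "c * ((x\<^sup>2 + v\<^sup>2) / 2 - \<beta>) \<le> c * (x\<^sup>2 + (\<bar>v\<bar> - sqrt \<beta>)\<^sup>2)"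
      using c(1) by (intro mult_left_mono) auto
    also have "\<dots> \<le> Re (saddle_phase \<beta> (x, v))" by (rule c(2))
    finally have "L * (c * ((x\<^sup>2 + v\<^sup>2) / 2 - \<beta>)) \<le> L * Re (saddle_phase \<beta> (x, v))"
      using L by (intro mult_left_mono) auto
    then show "norm (exp (- of_real L * saddle_phase \<beta> z)) \<le> exp (L * c * \<beta>) * exp (- (L * c / 2) * (norm z)\<^sup>2)"
      unfolding exp_add[symmetric] by (simp add: norm_exp_eq_Re z norm_Pair algebra_simps)
  qed (use L c in \<open>auto intro!: continuous_intros\<close>)
qed

text \<open>
  The shift acts on the first coordinate for every fixed value of the second one; Fubini's theorem
  leads from the plane to the lines and back.
\<close>

lemma heat_kernel_axis_eq_phase:
  fixes \<beta> s t \<mu> L :: real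
  assumes \<beta>: "\<beta> > 3" and t: "t > 0" and \<mu>: "\<mu> > 0" and L: "L = t * \<mu> ^ 4" and s: "s * \<mu> = 4 * (\<beta>\<^sup>2 - 1) * L"
  shows "heat_kernel \<beta> (s, 0) t = of_real (\<mu>\<^sup>2 * exp (- 3 * (\<beta>\<^sup>2 - 1) * L) / (2 * pi)\<^sup>2)
     * (LINT z|lborel. exp (- of_real L * saddle_phase \<beta> z))"
proof -
  have L0: "L > 0" using t \<mu> L by simp
  let ?h = "\<lambda>\<xi>. exp (\<i> * of_real (\<xi> \<bullet> (s, 0)) - of_real (t * quartic_symbol \<beta> \<xi>))"
  let ?a = "4 * (\<beta>\<^sup>2 - 1)"
  define f where "f v z = exp (of_real L * (\<i> * of_real ?a * z - z ^ 4 - of_real (2 * \<beta> * v\<^sup>2) * z\<^sup>2 + of_real (- (v ^ 4))))"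
    for v :: real and z :: complex
  have int: "integrable lborel ?h"
    by (rule integrable_heat_integrand) (use \<beta> t in auto)
  have h_f: "?h (\<mu> *\<^sub>R z) = f (snd z) (of_real (fst z))" for z
  proof -
    have i: "\<mu> *\<^sub>R z \<bullet> (s, 0) = ?a * L * fst z"
      using s by (cases z) (simp add: mult_ac)
    have q: "t * quartic_symbol \<beta> (\<mu> *\<^sub>R z) = L * quartic_symbol \<beta> z"
      by (simp add: L quartic_symbol_def power2_eq_square power4_eq_xxxx algebra_simps)
    show ?thesis
      unfolding f_def i q by (intro arg_cong[where f = exp]) (simp add: quartic_symbol_def algebra_simps)
  qed
  have f_shift: "f v (of_real x + \<i>) = of_real (exp (- 3 * (\<beta>\<^sup>2 - 1) * L)) * exp (- of_real L * saddle_phase \<beta> (x, v))" for x v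
  proof -
    have "of_real L * (\<i> * of_real ?a * (of_real x + \<i>) - (of_real x + \<i>) ^ 4 - of_real (2 * \<beta> * v\<^sup>2) * (of_real x + \<i>)\<^sup>2 + of_real (- (v ^ 4)))
      = of_real (- 3 * (\<beta>\<^sup>2 - 1) * L) + - of_real L * saddle_phase \<beta> (x, v)"
      by (simp add: saddle_phase_def Let_def complex_eq_iff power2_eq_square power4_eq_xxxx power3_eq_cube algebra_simps)
    then show ?thesis
      unfolding f_def by (simp only: exp_add exp_of_real)
  qed
  have "integrable lborel (\<lambda>z. ?h (\<mu> *\<^sub>R z))"
  proof -
    have "?h (\<mu> *\<^sub>R z) = exp (\<i> * of_real (z \<bullet> (\<mu> * s, 0)) - of_real (L * quartic_symbol \<beta> z))" for z
      by (intro arg_cong[where f = exp]; cases z)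
         (simp add: L quartic_symbol_def power2_eq_square power4_eq_xxxx algebra_simps)
    then show ?thesis
      using integrable_heat_integrand[of \<beta> L "(\<mu> * s, 0)"] \<beta> L0 by simp
  qed
  then have int_f: "integrable lborel (\<lambda>z. f (snd z) (of_real (fst z)))"
    unfolding h_f .
  have int_shift: "integrable lborel (\<lambda>z. f (snd z) (of_real (fst z) + \<i>))"
    using integrable_exp_saddle_phase[OF \<beta> L0] by (simp add: f_shift)
  have "(LINT \<xi>|lborel. ?h \<xi>) = of_real (\<mu> ^ DIM(real \<times> real)) * (LINT z|lborel. ?h (0 + \<mu> *\<^sub>R z))"
    by (rule lborel_integral_affine) (use \<mu> borel_measurable_integrable[OF int] in auto)
  also have "\<dots> = of_real (\<mu>\<^sup>2) * (LINT z|lborel. ?h (\<mu> *\<^sub>R z))"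
    by (simp only: add_0_left DIM_prod DIM_real one_add_one)
  also have "(LINT z|lborel. ?h (\<mu> *\<^sub>R z)) = (LINT z|lborel. f (snd z) (of_real (fst z)))"
    by (simp only: h_f)
  also have "\<dots> = (LINT v|lborel. LINT x|lborel. f v (of_real x))"
    using integral_lborel_snd[OF int_f] by simp
  also have "\<dots> = (LINT v|lborel. LINT x|lborel. f v (of_real x + \<i>))"
  proof (rule Bochner_Integration.integral_cong[OF refl])
    fix v :: real
    have "1 \<le> \<beta>\<^sup>2" using \<beta> power_mono[of 1 \<beta> 2] by simp
    then show "(LINT x|lborel. f v (of_real x)) = (LINT x|lborel. f v (of_real x + \<i>))"
      unfolding f_def using L0 \<beta> by (intro integral_exp_quartic_shift) auto
  qed
  also have "\<dots> = (LINT z|lborel. f (snd z) (of_real (fst z) + \<i>))"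
    using integral_lborel_snd[OF int_shift] by simp
  also have "\<dots> = of_real (exp (- 3 * (\<beta>\<^sup>2 - 1) * L)) * (LINT z|lborel. exp (- of_real L * saddle_phase \<beta> z))"
    by (simp add: f_shift)
  finally show ?thesis
    unfolding heat_kernel_def by simp
qed

text \<open>
  Completing the square in \<open>snd z\<close> turns the mixed imaginary term into an imaginary offset of the line,
  and leaves \<open>6 * (\<beta>\<^sup>2 - 1) * (fst z)\<^sup>2\<close>.
\<close>

lemma gaussian_integral_axis_saddle:
  fixes \<beta> \<sigma> :: real
  assumes \<beta>: "\<beta> > 3" and \<sigma>: "\<sigma> = 1 \<or> \<sigma> = -1"
  shows "(LINT z|lborel. exp (- (of_real (4 * \<beta> * (snd z)\<^sup>2 + (2 * \<beta>\<^sup>2 - 6) * (fst z)\<^sup>2)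
             + \<i> * of_real (8 * \<sigma> * \<beta> * sqrt \<beta> * fst z * snd z))))
    = of_real (pi / sqrt (24 * \<beta> * (\<beta>\<^sup>2 - 1)))"
proof -
  let ?q = "\<lambda>z::real\<times>real. of_real (4 * \<beta> * (snd z)\<^sup>2 + (2 * \<beta>\<^sup>2 - 6) * (fst z)\<^sup>2)
             + \<i> * of_real (8 * \<sigma> * \<beta> * sqrt \<beta> * fst z * snd z)"
  have \<beta>2: "\<beta>\<^sup>2 > 9" using \<beta> power_strict_mono[of 3 \<beta> 2] by simp
  define m where "m = min (4 * \<beta>) (2 * \<beta>\<^sup>2 - 6)"
  have m: "m > 0" "m \<le> 4 * \<beta>" "m \<le> 2 * \<beta>\<^sup>2 - 6" using \<beta> \<beta>2 by (auto simp: m_def)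
  have int: "integrable lborel (\<lambda>z. exp (- ?q z))"
  proof (rule integrable_bounded_by_gaussian_prod[OF _ m(1), where C = 1])
    fix z :: "real \<times> real"
    have "m * (fst z)\<^sup>2 \<le> (2 * \<beta>\<^sup>2 - 6) * (fst z)\<^sup>2" "m * (snd z)\<^sup>2 \<le> 4 * \<beta> * (snd z)\<^sup>2"
      using m by (auto intro: mult_right_mono)
    then have "m * (norm z)\<^sup>2 \<le> Re (?q z)"
      by (cases z) (simp add: norm_Pair distrib_left)
    then show "norm (exp (- ?q z)) \<le> 1 * exp (- m * (norm z)\<^sup>2)"
      by (simp add: norm_exp_eq_Re)
  qed (intro continuous_intros)
  have inner: "(LINT p|lborel. exp (- ?q (x, p))) = of_real (sqrt (pi / (4 * \<beta>)) * exp (- (6 * (\<beta>\<^sup>2 - 1)) * x\<^sup>2))" for x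
  proof -
    have "(LINT p|lborel. exp (- ?q (x, p)))
      = (LINT p|lborel. of_real (exp (- (6 * (\<beta>\<^sup>2 - 1)) * x\<^sup>2))
           * exp (- of_real (4 * \<beta>) * (of_real p + \<i> * of_real (\<sigma> * sqrt \<beta> * x + 0 * p))\<^sup>2))"
    proof (rule Bochner_Integration.integral_cong[OF refl])
      fix p :: real
      have sq: "(\<sigma> * sqrt \<beta> * x)\<^sup>2 = \<beta> * x\<^sup>2"
        using \<sigma> \<beta> by (auto simp: power_mult_distrib)
      have "(of_real p + \<i> * of_real y)\<^sup>2 = of_real (p\<^sup>2 - y\<^sup>2) + \<i> * of_real (2 * p * y)" for y
        by (simp add: complex_eq_iff power2_eq_square)
      from this[of "\<sigma> * sqrt \<beta> * x"]
      have "(of_real p + \<i> * of_real (\<sigma> * sqrt \<beta> * x + 0 * p))\<^sup>2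
          = of_real (p\<^sup>2 - \<beta> * x\<^sup>2) + \<i> * of_real (2 * p * (\<sigma> * sqrt \<beta> * x))"
        unfolding sq by simp
      then have "- ?q (x, p) = of_real (- (6 * (\<beta>\<^sup>2 - 1)) * x\<^sup>2)
          + - of_real (4 * \<beta>) * (of_real p + \<i> * of_real (\<sigma> * sqrt \<beta> * x + 0 * p))\<^sup>2"
        by (simp only:) (simp add: complex_eq_iff power2_eq_square algebra_simps)
      then show "exp (- ?q (x, p)) = of_real (exp (- (6 * (\<beta>\<^sup>2 - 1)) * x\<^sup>2))
           * exp (- of_real (4 * \<beta>) * (of_real p + \<i> * of_real (\<sigma> * sqrt \<beta> * x + 0 * p))\<^sup>2)"
        by (simp only: exp_add exp_of_real)
    qed
    then show ?thesis
      using gaussian_line_integral[of "4 * \<beta>" 0 "\<sigma> * sqrt \<beta> * x"] \<beta> by simp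
  qed
  have "(LINT z|lborel. exp (- ?q z)) = (LINT x|lborel. of_real (sqrt (pi / (4 * \<beta>)) * exp (- (6 * (\<beta>\<^sup>2 - 1)) * x\<^sup>2)))"
    unfolding integral_lborel_fst[OF int] inner ..
  also have "\<dots> = of_real (sqrt (pi / (4 * \<beta>)) * sqrt (pi / (6 * (\<beta>\<^sup>2 - 1))))"
    using has_bochner_integral_gaussian[of "6 * (\<beta>\<^sup>2 - 1)"] \<beta>2
    by (simp only: integral_complex_of_real) (simp add: has_bochner_integral_iff)
  also have "sqrt (pi / (4 * \<beta>)) * sqrt (pi / (6 * (\<beta>\<^sup>2 - 1))) = sqrt (pi\<^sup>2 / (24 * \<beta> * (\<beta>\<^sup>2 - 1)))"
    unfolding real_sqrt_mult[symmetric] by (simp add: power2_eq_square mult_ac)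
  also have "\<dots> = pi / sqrt (24 * \<beta> * (\<beta>\<^sup>2 - 1))"
    by (simp add: real_sqrt_divide)
  finally show ?thesis .
qed

text \<open>
  Near \<open>(0, \<sigma> * sqrt \<beta>)\<close> the quantity \<open>W\<close> of \<open>saddle_phase\<close> is \<open>2 * \<sigma> * sqrt \<beta> * p\<close> to first
  order in the displacement \<open>p\<close> of \<open>v\<close>, while \<open>x\<^sup>2 * W\<close> and \<open>x ^ 3\<close> are of third order; this
  yields the limiting quadratic form.
\<close>

lemma axis_saddle_contribution:
  fixes \<beta> \<sigma> :: real and S :: "(real \<times> real) set"
  assumes \<beta>: "\<beta> > 3" and \<sigma>: "\<sigma> = 1 \<or> \<sigma> = -1"
    and S_borel: "S \<in> sets borel" and int: "(0, \<sigma> * sqrt \<beta>) \<in> interior S" and S: "\<And>z. z \<in> S \<Longrightarrow> \<sigma> * snd z \<ge> 0"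
  shows "((\<lambda>k. of_real (k\<^sup>2) * (LINT z:S|lborel. exp (- of_real (k\<^sup>2) * saddle_phase \<beta> z)))
     \<longlongrightarrow> of_real (pi / sqrt (24 * \<beta> * (\<beta>\<^sup>2 - 1)))) at_top"
proof -
  let ?q = "\<lambda>z::real\<times>real. of_real (4 * \<beta> * (snd z)\<^sup>2 + (2 * \<beta>\<^sup>2 - 6) * (fst z)\<^sup>2)
             + \<i> * of_real (8 * \<sigma> * \<beta> * sqrt \<beta> * fst z * snd z)"
  obtain c where c: "c > 0" "\<And>x v. c * (x\<^sup>2 + (\<bar>v\<bar> - sqrt \<beta>)\<^sup>2) \<le> Re (saddle_phase \<beta> (x, v))"
    using saddle_phase_coercive[OF \<beta>] by auto
  have "((\<lambda>k. of_real (k ^ DIM(real \<times> real)) * (LINT z:S|lborel. exp (- of_real (k\<^sup>2) * saddle_phase \<beta> z)))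
     \<longlongrightarrow> (LINT z|lborel. exp (- ?q z))) at_top"
  proof (rule laplace_complex_phase[OF _ _ S_borel int integrable_gaussian_prod[OF c(1)]])
    fix z :: "real \<times> real" assume "z \<in> S"
    obtain x v where z: "z = (x, v)" by (cases z)
    have "\<sigma> * v \<ge> 0" using S[OF \<open>z \<in> S\<close>] by (simp add: z)
    then have "(v - \<sigma> * sqrt \<beta>)\<^sup>2 = (\<bar>v\<bar> - sqrt \<beta>)\<^sup>2"
      using \<sigma> by (auto simp: power2_eq_square algebra_simps)
    then show "c * (norm (z - (0, \<sigma> * sqrt \<beta>)))\<^sup>2 \<le> Re (saddle_phase \<beta> z)"
      using c(2)[of x v] by (simp add: z norm_Pair)
  next
    fix z :: "real \<times> real"
    obtain x p where z: "z = (x, p)" by (cases z)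
    let ?w = "\<lambda>h. 2 * \<sigma> * sqrt \<beta> * p + p\<^sup>2 * h"
    let ?g = "\<lambda>h. of_real ((?w h)\<^sup>2 + 2 * \<beta> * x\<^sup>2 * ?w h * h + x ^ 4 * h\<^sup>2 + (2 * \<beta>\<^sup>2 - 6) * x\<^sup>2)
             + \<i> * of_real (4 * \<beta> * x * ?w h + 4 * x ^ 3 * h)"
    have "((\<lambda>k. ?g (1 / k)) \<longlongrightarrow> ?g 0) at_top"
      by (intro tendsto_add tendsto_mult tendsto_const tendsto_of_real tendsto_power
            tendsto_divide_0[OF tendsto_const] filterlim_at_top_imp_at_infinity filterlim_ident)
    moreover have "?g 0 = ?q z"
      using \<sigma> \<beta> by (auto simp: z complex_eq_iff power2_eq_square algebra_simps)
    ultimately have "((\<lambda>k. ?g (1 / k)) \<longlongrightarrow> ?q z) at_top" by simp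
    moreover have "\<forall>\<^sub>F k in at_top. ?g (1 / k) = of_real (k\<^sup>2) * saddle_phase \<beta> ((0, \<sigma> * sqrt \<beta>) + (1 / k) *\<^sub>R z)"
      using eventually_gt_at_top[of 0]
    proof eventually_elim
      case (elim k)
      define h where "h = 1 / k"
      have k: "k = 1 / h" and h: "h \<noteq> 0" using elim by (auto simp: h_def)
      have W: "(\<sigma> * sqrt \<beta> + h * p)\<^sup>2 - \<beta> = h * ?w h"
        using \<sigma> \<beta> by (auto simp: power2_eq_square algebra_simps)
      have "saddle_phase \<beta> ((0, \<sigma> * sqrt \<beta>) + h *\<^sub>R z) = of_real (h\<^sup>2) * ?g h"
        by (simp add: saddle_phase_def Let_def z W complex_eq_iff)
           (simp add: power2_eq_square power3_eq_cube power4_eq_xxxx algebra_simps)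
      then show ?case
        using elim h unfolding k by (simp add: power_divide)
    qed
    ultimately show "((\<lambda>k. of_real (k\<^sup>2) * saddle_phase \<beta> ((0, \<sigma> * sqrt \<beta>) + (1 / k) *\<^sub>R z)) \<longlongrightarrow> ?q z) at_top"
      by (rule Lim_transform_eventually)
  qed (auto intro!: borel_measurable_continuous_onI continuous_intros)
  then show ?thesis
    unfolding gaussian_integral_axis_saddle[OF \<beta> \<sigma>] by (simp only: DIM_prod DIM_real one_add_one)
qed

text \<open>
  The upper and the lower half-plane contain one saddle point each, with equal
  contributions.
\<close>

lemma saddle_integral_asymptotics:
  assumes \<beta>: "\<beta> > 3"
  shows "((\<lambda>k. of_real (k\<^sup>2) * (LINT z|lborel. exp (- of_real (k\<^sup>2) * saddle_phase \<beta> z)))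
     \<longlongrightarrow> of_real (2 * pi / sqrt (24 * \<beta> * (\<beta>\<^sup>2 - 1)))) at_top"
proof -
  let ?P = "{z::real \<times> real. 0 < snd z}" and ?N = "{z::real \<times> real. snd z \<le> 0}"
  let ?F = "\<lambda>k z. exp (- of_real (k\<^sup>2) * saddle_phase \<beta> z)"
  have open_P: "open ?P" and open_N: "open {z::real \<times> real. snd z < 0}"
    by (intro open_Collect_less continuous_intros)+
  have closed_N: "closed ?N"
    by (intro closed_Collect_le continuous_intros)
  have P: "((\<lambda>k. of_real (k\<^sup>2) * (LINT z:?P|lborel. ?F k z)) \<longlongrightarrow> of_real (pi / sqrt (24 * \<beta> * (\<beta>\<^sup>2 - 1)))) at_top"
    by (rule axis_saddle_contribution[OF \<beta>, of 1]) (use open_P \<beta> in \<open>auto simp: interior_open\<close>)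
  have N: "((\<lambda>k. of_real (k\<^sup>2) * (LINT z:?N|lborel. ?F k z)) \<longlongrightarrow> of_real (pi / sqrt (24 * \<beta> * (\<beta>\<^sup>2 - 1)))) at_top"
  proof (rule axis_saddle_contribution[OF \<beta>, of "-1"])
    have "(0, - 1 * sqrt \<beta>) \<in> {z. snd z < 0}" using \<beta> by simp
    also have "{z. snd z < 0} \<subseteq> interior ?N"
      by (intro interior_maximal open_N) auto
    finally show "(0, - 1 * sqrt \<beta>) \<in> interior ?N" .
  qed (use closed_N in auto)
  have "((\<lambda>k. of_real (k\<^sup>2) * (LINT z:?P|lborel. ?F k z) + of_real (k\<^sup>2) * (LINT z:?N|lborel. ?F k z))
      \<longlongrightarrow> of_real (2 * pi / sqrt (24 * \<beta> * (\<beta>\<^sup>2 - 1)))) at_top"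
    using tendsto_add[OF P N] by (simp flip: of_real_add)
  moreover have "\<forall>\<^sub>F k in at_top. of_real (k\<^sup>2) * (LINT z:?P|lborel. ?F k z) + of_real (k\<^sup>2) * (LINT z:?N|lborel. ?F k z)
      = of_real (k\<^sup>2) * (LINT z|lborel. ?F k z)"
    using eventually_gt_at_top[of 0]
  proof eventually_elim
    case (elim k)
    have int: "integrable lborel (?F k)"
      using elim by (intro integrable_exp_saddle_phase \<beta>) simp
    have "(LINT z:?P \<union> ?N|lborel. ?F k z) = (LINT z:?P|lborel. ?F k z) + (LINT z:?N|lborel. ?F k z)"
      by (intro set_integral_Un) (use int open_P closed_N in \<open>auto simp: set_integrable_def intro!: integrable_mult_indicator\<close>)
    moreover have "?P \<union> ?N = UNIV" by auto
    ultimately show ?case by (simp add: set_lebesgue_integral_def distrib_left)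
  qed
  ultimately show ?thesis by (rule Lim_transform_eventually)
qed

text \<open>
  Here \<open>\<mu> ^ 3 = s / (4 * (\<beta>\<^sup>2 - 1) * t)\<close> and \<open>k\<^sup>2 = t * \<mu> ^ 4\<close>. Fractional powers are rewritten
  as powers of \<open>S\<close>, \<open>T\<close>, \<open>D\<close> and \<open>a = 2 powr (1/6)\<close> to compare the constants.
\<close>

lemma axis_asymptotics:
  fixes \<beta> s :: real
  assumes \<beta>: "\<beta> > 3" and s: "s > 0"
  shows "((\<lambda>t. heat_kernel \<beta> (s, 0) t /
       complex_of_real (
          1 / (2 powr (7/6) * 3 powr (1/2) * pi)
          * \<beta> powr (-1/2) * (\<beta>\<^sup>2 - 1) powr (1/6)
          * s powr (-2/3) * t powr (-1/3)
          * exp (- (3 / 4 powr (4/3)) * (\<beta>\<^sup>2 - 1) powr (-1/3)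
                 * (s powr (4/3) / t powr (1/3))))) \<longlongrightarrow> 1) (at_right 0)"
proof -
  define S where "S = s powr (1/3)"
  define a where "a = (2 :: real) powr (1/6)"
  define D where "D = (\<beta>\<^sup>2 - 1) powr (1/3)"
  have \<beta>2: "\<beta>\<^sup>2 > 1" using \<beta> power_strict_mono[of 1 \<beta> 2] by simp
  have S: "S > 0" "S ^ 3 = s" "s powr (-2/3) = 1 / S\<^sup>2" "s powr (4/3) = S ^ 4"
    using s by (simp_all add: S_def powr_powr powr_minus_divide flip: powr_realpow)
  have D: "D > 0" "D ^ 3 = \<beta>\<^sup>2 - 1" "(\<beta>\<^sup>2 - 1) powr (-1/3) = 1 / D"
    using \<beta>2 by (simp_all add: D_def powr_powr powr_minus_divide flip: powr_realpow)
  have D6: "(\<beta>\<^sup>2 - 1) powr (1/6) = sqrt D"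
    using \<beta>2 by (simp add: D_def powr_powr flip: powr_half_sqrt)
  have a: "a > 0" "a ^ 6 = 2"
    by (simp_all add: a_def powr_powr flip: powr_realpow)
  have a7: "(2 :: real) powr (7/6) = 2 * a"
    using powr_add[of 2 1 "1/6 :: real"] by (simp add: a_def)
  have a3: "sqrt 2 = a ^ 3"
    by (simp add: a_def powr_powr flip: powr_realpow powr_half_sqrt)
  have four: "(4 :: real) powr x = 2 powr (2 * x)" for x
    using powr_powr[of 2 2 x] by simp
  have F4: "(4 :: real) powr (4/3) = 4 * a ^ 4"
    using powr_add[of 2 2 "2/3 :: real"] by (simp add: a_def four powr_powr flip: powr_realpow)
  define k where "k t = sqrt (S ^ 4 / (4 * a ^ 4 * D ^ 4)) / sqrt (t powr (1/3))" for t :: real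
  define I where "I k = (LINT z|lborel. exp (- of_real (k\<^sup>2) * saddle_phase \<beta> z))" for k :: real
  define g where "g = 2 * pi / sqrt (24 * \<beta> * (\<beta>\<^sup>2 - 1))"
  have g: "g > 0" using \<beta> \<beta>2 by (simp add: g_def)
  have "S ^ 4 / (4 * a ^ 4 * D ^ 4) > 0" using S a D by simp
  then have k_lim: "filterlim k at_top (at_right 0)"
    unfolding k_def[abs_def] by real_asymp
  have "((\<lambda>k. of_real (k\<^sup>2) * I k) \<longlongrightarrow> of_real g) at_top"
    unfolding I_def[abs_def] g_def by (rule saddle_integral_asymptotics[OF \<beta>])
  then have "((\<lambda>k. of_real (k\<^sup>2) * I k / of_real g) \<longlongrightarrow> of_real g / of_real g) at_top"
    by (intro tendsto_divide tendsto_const) (use g in auto)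
  then have "((\<lambda>k. of_real (k\<^sup>2) * I k / of_real g) \<longlongrightarrow> 1) at_top"
    using g by simp
  then have "((\<lambda>t. of_real ((k t)\<^sup>2) * I (k t) / of_real g) \<longlongrightarrow> 1) (at_right 0)"
    by (rule filterlim_compose[OF _ k_lim])
  moreover have "\<forall>\<^sub>F t in at_right 0. of_real ((k t)\<^sup>2) * I (k t) / of_real g = heat_kernel \<beta> (s, 0) t /
       complex_of_real (
          1 / (2 powr (7/6) * 3 powr (1/2) * pi)
          * \<beta> powr (-1/2) * (\<beta>\<^sup>2 - 1) powr (1/6)
          * s powr (-2/3) * t powr (-1/3)
          * exp (- (3 / 4 powr (4/3)) * (\<beta>\<^sup>2 - 1) powr (-1/3)
                 * (s powr (4/3) / t powr (1/3))))"
    using eventually_at_right_less[of 0]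
  proof eventually_elim
    case (elim t)
    define T where "T = t powr (1/3)"
    have T: "T > 0" "T ^ 3 = t" "t powr (-1/3) = 1 / T"
      using elim by (simp_all add: T_def powr_powr powr_minus_divide flip: powr_realpow)
    define \<mu> where "\<mu> = S / (a ^ 4 * D * T)"
    define K where "K = k t"
    have \<mu>: "\<mu> > 0" using S a D T by (simp add: \<mu>_def)
    have K: "K > 0" "K\<^sup>2 = S ^ 4 / (4 * a ^ 4 * D ^ 4 * T)"
      using S a D T by (simp_all add: K_def k_def T_def[symmetric] power_divide)
    have "a ^ 12 = 4"
      using power_mult[of a 6 2] a(2) by simp
    moreover have "a ^ 16 = a ^ 12 * a ^ 4"
      by (simp flip: power_add)
    ultimately have a16: "a ^ 16 = 4 * a ^ 4"
      by simp
    have tmu: "K\<^sup>2 = t * \<mu> ^ 4"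
    proof -
      have "t * \<mu> ^ 4 = S ^ 4 / (a ^ 16 * D ^ 4 * T)"
        using T(1) S(1) D(1) a(1) unfolding \<mu>_def T(2)[symmetric]
        by (simp add: power_divide power_mult_distrib power3_eq_cube power4_eq_xxxx[of T] flip: power_mult)
      then show ?thesis unfolding K a16 by simp
    qed
    have smu: "s * \<mu> = 4 * (\<beta>\<^sup>2 - 1) * K\<^sup>2"
      using T(1) S(1) D(1) a(1) unfolding \<mu>_def S(2)[symmetric] D(2)[symmetric] K(2)
      by (simp add: field_simps power3_eq_cube power4_eq_xxxx)
    define E where "E = exp (- 3 * (\<beta>\<^sup>2 - 1) * K\<^sup>2)"
    have E: "exp (- (3 / 4 powr (4/3)) * (\<beta>\<^sup>2 - 1) powr (-1/3) * (s powr (4/3) / t powr (1/3))) = E"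
      unfolding E_def F4 D(3) S(4) K(2) T_def[symmetric] unfolding D(2)[symmetric]
      using T(1) S(1) D(1) a(1) by (simp add: field_simps power3_eq_cube power4_eq_xxxx)
    have G: "heat_kernel \<beta> (s, 0) t = of_real (\<mu>\<^sup>2 * E / (2 * pi)\<^sup>2) * I K"
      unfolding E_def I_def by (rule heat_kernel_axis_eq_phase[OF \<beta> elim \<mu> tmu smu])
    have const: "1 / (2 powr (7/6) * 3 powr (1/2) * pi) * \<beta> powr (-1/2) * (\<beta>\<^sup>2 - 1) powr (1/6)
        = D\<^sup>2 / (a ^ 4 * pi\<^sup>2) * g"
    proof -
      have s24: "sqrt (24 * \<beta> * D ^ 3) = 2 * a ^ 3 * sqrt 3 * sqrt \<beta> * (D * sqrt D)"
      proof -
        have "24 * \<beta> * D ^ 3 = 2\<^sup>2 * 2 * 3 * \<beta> * (D\<^sup>2 * D)" by (simp add: power3_eq_cube power2_eq_square)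
        then have "sqrt (24 * \<beta> * D ^ 3) = 2 * sqrt 2 * sqrt 3 * sqrt \<beta> * (D * sqrt D)"
          using D(1) by (simp only: real_sqrt_mult real_sqrt_abs)
        then show ?thesis by (simp only: a3)
      qed
      have b: "\<beta> powr (-1/2) = 1 / sqrt \<beta>" "3 powr (1/2) = sqrt 3"
        using \<beta> by (simp_all add: powr_minus_divide flip: powr_half_sqrt)
      have a7': "a ^ 4 * a ^ 3 = 2 * a" using a(2) power_add[of a 6 1] by (simp flip: power_add)
      have "D\<^sup>2 / (a ^ 4 * pi\<^sup>2) * g = D\<^sup>2 / ((a ^ 4 * a ^ 3) * pi * sqrt 3 * sqrt \<beta> * (D * sqrt D))"
        unfolding g_def D(2)[symmetric] s24 using a D \<beta> by (simp add: field_simps power2_eq_square)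
      also have "\<dots> = 1 / (2 * a * sqrt 3 * pi) * (1 / sqrt \<beta>) * (D / sqrt D)"
        unfolding a7' using a D \<beta> by (simp add: field_simps power2_eq_square)
      also have "D / sqrt D = sqrt D" using D(1) by (simp add: real_div_sqrt)
      finally show ?thesis unfolding a7 D6 b by simp
    qed
    have P: "1 / (2 powr (7/6) * 3 powr (1/2) * pi)
          * \<beta> powr (-1/2) * (\<beta>\<^sup>2 - 1) powr (1/6)
          * s powr (-2/3) * t powr (-1/3)
          * exp (- (3 / 4 powr (4/3)) * (\<beta>\<^sup>2 - 1) powr (-1/3)
                 * (s powr (4/3) / t powr (1/3))) = \<mu>\<^sup>2 * E / (2 * pi)\<^sup>2 / K\<^sup>2 * g"
    proof -
      have "\<mu>\<^sup>2 / (4 * K\<^sup>2) = D\<^sup>2 / a ^ 4 * (1 / S\<^sup>2) * (1 / T)"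
        using T(1) S(1) D(1) a(1) unfolding \<mu>_def K(2) by (simp add: field_simps power2_eq_square power4_eq_xxxx)
      moreover have "\<mu>\<^sup>2 * E / (2 * pi)\<^sup>2 / K\<^sup>2 * g = \<mu>\<^sup>2 / (4 * K\<^sup>2) * E / pi\<^sup>2 * g"
        by (simp add: power_mult_distrib)
      ultimately show ?thesis
        unfolding E const S(3) T(3) by (simp add: mult_ac)
    qed
    define m where "m = \<mu>\<^sup>2 * E / (2 * pi)\<^sup>2"
    have "m > 0" using \<mu> by (simp add: m_def E_def)
    then have "of_real (K\<^sup>2) * I K / of_real g = of_real m * I K / complex_of_real (m / K\<^sup>2 * g)"
      using K(1) g by simp
    then show ?case
      unfolding G P K_def[symmetric] m_def .
  qed
  ultimately show ?thesis by (rule Lim_transform_eventually)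
qed

text \<open>
  The rotation transfers the axis formula with parameter \<open>(3 - \<beta>) / (1 + \<beta>) > 3\<close> and time
  \<open>(1 + \<beta>) / 8 * t\<close>; what remains is the comparison of constants, based on
  \<open>((3 - \<beta>) / (1 + \<beta>))\<^sup>2 - 1 = 8 * (1 - \<beta>) / (1 + \<beta>)\<^sup>2\<close>.
\<close>

lemma diagonal_asymptotics:
  fixes \<beta> s :: real
  assumes \<beta>: "-1 < \<beta>" "\<beta> < 0" and s: "s > 0"
  shows "((\<lambda>t. heat_kernel \<beta> (s, s) t /
       complex_of_real (
          1 / (3 powr (1/2) * 4 powr (1/3) * pi)
          * ((1 - \<beta>) powr (1/6) / ((3 - \<beta>) powr (1/2) * (1 + \<beta>) powr (1/6)))
          * s powr (-2/3) * t powr (-1/3)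
          * exp (- (3 / 4 powr (4/3)) * ((1 + \<beta>) / (1 - \<beta>)) powr (1/3)
                 * (s powr (4/3) / t powr (1/3))))) \<longlongrightarrow> 1) (at_right 0)"
proof -
  define \<beta>' where "\<beta>' = (3 - \<beta>) / (1 + \<beta>)"
  define \<kappa> where "\<kappa> = (1 + \<beta>) / 8"
  have \<beta>': "\<beta>' > 3" using \<beta> by (simp add: \<beta>'_def field_simps)
  have \<kappa>: "\<kappa> > 0" using \<beta> by (simp add: \<kappa>_def)
  define a where "a = (2 :: real) powr (1/6)"
  define p where "p = (1 + \<beta>) powr (1/6)"
  define q where "q = (1 - \<beta>) powr (1/6)"
  define r where "r = (3 - \<beta>) powr (1/2)"
  have a: "a > 0" "a ^ 6 = 2"
    by (simp_all add: a_def powr_powr flip: powr_realpow)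
  have p: "p > 0" "(1 + \<beta>) powr (1/3) = p\<^sup>2" "(1 + \<beta>) powr (1/2) = p ^ 3"
    using \<beta> by (simp_all add: p_def powr_powr flip: powr_realpow)
  have q: "q > 0" "(1 - \<beta>) powr (1/3) = q\<^sup>2"
    using \<beta> by (simp_all add: q_def powr_powr flip: powr_realpow)
  have r: "r > 0" using \<beta> by (simp add: r_def)
  have a7: "(2 :: real) powr (7/6) = 2 * a"
    using powr_add[of 2 1 "1/6 :: real"] by (simp add: a_def)
  have two: "(4 :: real) powr (1/3) = a ^ 4" "(8 :: real) powr (1/6) = a ^ 3" "(8 :: real) powr (1/3) = 2"
    using powr_powr[of 2 2 "1/3 :: real"] powr_powr[of 2 3 "1/6 :: real"] powr_powr[of 2 3 "1/3 :: real"]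
    by (simp_all add: a_def powr_powr flip: powr_realpow)
  have b1: "\<beta>' powr (-1/2) = p ^ 3 / r"
    using \<beta> p by (simp add: \<beta>'_def powr_minus_divide powr_divide r_def)
  have b2: "\<beta>'\<^sup>2 - 1 = 8 * (1 - \<beta>) / ((1 + \<beta>) * (1 + \<beta>))"
  proof -
    have "\<beta>'\<^sup>2 - 1 = (\<beta>' - 1) * (\<beta>' + 1)"
      by (simp add: power2_eq_square algebra_simps)
    moreover have "\<beta>' - 1 = 2 * (1 - \<beta>) / (1 + \<beta>)" "\<beta>' + 1 = 4 / (1 + \<beta>)"
      using \<beta> by (simp_all add: \<beta>'_def field_simps)
    ultimately show ?thesis by simp
  qed
  have b: "(\<beta>'\<^sup>2 - 1) powr x = 8 powr x * (1 - \<beta>) powr x / ((1 + \<beta>) powr x * (1 + \<beta>) powr x)" for x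
  proof -
    have "(8 * (1 - \<beta>)) powr x = 8 powr x * (1 - \<beta>) powr x"
      and "((1 + \<beta>) * (1 + \<beta>)) powr x = (1 + \<beta>) powr x * (1 + \<beta>) powr x"
      and "(8 * (1 - \<beta>) / ((1 + \<beta>) * (1 + \<beta>))) powr x = (8 * (1 - \<beta>)) powr x / ((1 + \<beta>) * (1 + \<beta>)) powr x"
      using \<beta> powr_mult[of 8 "1 - \<beta>" x] powr_mult[of "1 + \<beta>" "1 + \<beta>" x]
        powr_divide[of "8 * (1 - \<beta>)" "(1 + \<beta>) * (1 + \<beta>)" x] by auto
    then show ?thesis unfolding b2 by simp
  qed
  have b3: "(\<beta>'\<^sup>2 - 1) powr (1/6) = a ^ 3 * q / (p * p)"
    unfolding b two p_def q_def ..
  have b4: "(\<beta>'\<^sup>2 - 1) powr (1/3) = 2 * q\<^sup>2 / (p\<^sup>2 * p\<^sup>2)"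
    unfolding b two p q ..
  have b5: "(\<beta>'\<^sup>2 - 1) powr (-1/3) = p ^ 4 / (2 * q\<^sup>2)"
    using powr_minus_divide[of "\<beta>'\<^sup>2 - 1" "1/3"] b4 by (simp add: power2_eq_square power4_eq_xxxx)
  have b6: "((1 + \<beta>) / (1 - \<beta>)) powr (1/3) = p\<^sup>2 / q\<^sup>2"
    using \<beta> by (simp add: powr_divide p q)
  have lim: "filterlim (\<lambda>t. \<kappa> * t) (at_right 0) (at_right 0)"
    using \<kappa> by real_asymp
  have "\<forall>\<^sub>F t in at_right 0. heat_kernel \<beta>' (s, 0) (\<kappa> * t) /
       complex_of_real (
          1 / (2 powr (7/6) * 3 powr (1/2) * pi)
          * \<beta>' powr (-1/2) * (\<beta>'\<^sup>2 - 1) powr (1/6)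
          * s powr (-2/3) * (\<kappa> * t) powr (-1/3)
          * exp (- (3 / 4 powr (4/3)) * (\<beta>'\<^sup>2 - 1) powr (-1/3)
                 * (s powr (4/3) / (\<kappa> * t) powr (1/3))))
    = heat_kernel \<beta> (s, s) t /
       complex_of_real (
          1 / (3 powr (1/2) * 4 powr (1/3) * pi)
          * ((1 - \<beta>) powr (1/6) / ((3 - \<beta>) powr (1/2) * (1 + \<beta>) powr (1/6)))
          * s powr (-2/3) * t powr (-1/3)
          * exp (- (3 / 4 powr (4/3)) * ((1 + \<beta>) / (1 - \<beta>)) powr (1/3)
                 * (s powr (4/3) / t powr (1/3))))"
    using eventually_at_right_less[of 0]
  proof eventually_elim
    case (elim t)
    have k1: "(\<kappa> * t) powr (1/3) = p\<^sup>2 / 2 * t powr (1/3)"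
      using \<beta> elim by (simp add: \<kappa>_def powr_mult powr_divide two p)
    have k2: "(\<kappa> * t) powr (-1/3) = 2 / p\<^sup>2 * t powr (-1/3)"
      using powr_minus_divide[of "\<kappa> * t" "1/3"] powr_minus_divide[of t "1/3"] k1 by simp
    have ex: "- (3 / 4 powr (4/3)) * (p ^ 4 / (2 * q\<^sup>2)) * (s powr (4/3) / (p\<^sup>2 / 2 * t powr (1/3)))
        = - (3 / 4 powr (4/3)) * (p\<^sup>2 / q\<^sup>2) * (s powr (4/3) / t powr (1/3))"
      using p by (simp add: power2_eq_square power4_eq_xxxx mult_ac)
    have pre: "1 / (2 * a * 3 powr (1/2) * pi) * (p ^ 3 / r) * (a ^ 3 * q / (p * p)) * x * (2 / p\<^sup>2 * y) * z
        = 2 * (1 / (3 powr (1/2) * a ^ 4 * pi) * (q / (r * p)) * x * y * z)" for x y z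
    proof -
      have "a ^ 3 / (2 * a) = 1 / a ^ 4"
      proof -
        have "a ^ 7 = 2 * a"
          using power_Suc2[of a 6] a(2) by simp
        then show ?thesis
          using a(1) by (simp add: divide_eq_eq eq_divide_eq flip: power_add)
      qed
      moreover have "1 / (2 * a * 3 powr (1/2) * pi) * (p ^ 3 / r) * (a ^ 3 * q / (p * p)) * x * (2 / p\<^sup>2 * y) * z
        = 2 * (1 / (3 powr (1/2) * pi) * (a ^ 3 / (2 * a)) * (q / (r * p)) * x * y * z)"
        using p r a by (simp add: field_simps power2_eq_square power3_eq_cube)
      ultimately show ?thesis by simp
    qed
    have H: "heat_kernel \<beta> (s, s) t = of_real (1 / 2) * heat_kernel \<beta>' (s, 0) (\<kappa> * t)"
      unfolding \<beta>'_def \<kappa>_def by (rule heat_kernel_rotation) (use \<beta> elim in auto)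
    show ?case
      unfolding H a7 b1 b3 b5 b6 k1 k2 ex pre two p_def[symmetric] q_def[symmetric] r_def[symmetric]
      by simp
  qed
  then show ?thesis
    by (rule Lim_transform_eventually[OF filterlim_compose[OF axis_asymptotics[OF \<beta>' s] lim]])
qed

section \<open>The four asymptotic formulae\<close>

theorem theorem2:
  fixes \<beta> s :: real
  assumes "\<beta> > -1" and "s > 0"
  shows
    "(\<beta> < 0 \<longrightarrow>
       (\<lambda>t. heat_kernel \<beta> (s, s) t) \<sim>[at_right 0]
       (\<lambda>t. complex_of_real (
          1 / (3 powr (1/2) * 4 powr (1/3) * pi)
          * ((1 - \<beta>) powr (1/6) / ((3 - \<beta>) powr (1/2) * (1 + \<beta>) powr (1/6)))
          * s powr (-2/3) * t powr (-1/3)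
          * exp (- (3 / 4 powr (4/3)) * ((1 + \<beta>) / (1 - \<beta>)) powr (1/3)
                 * (s powr (4/3) / t powr (1/3))))))
     \<and>
     (\<beta> = 0 \<longrightarrow>
       (\<exists>e \<in> o[at_right 0](\<lambda>_. 1). \<forall>\<^sub>F t in at_right 0.
          heat_kernel \<beta> (s, s) t =
          complex_of_real (
            1 / (3 * 4 powr (1/3) * pi) * s powr (-2/3) * t powr (-1/3)
            * exp (- (3 / 4 powr (4/3)) * (s powr (4/3) / t powr (1/3))))
          * (complex_of_real
               (1 + cos (3 * sqrt 3 / 4 powr (4/3) * (s powr (4/3) / t powr (1/3)) - pi/3))
             + e t)))
     \<and>
     (\<beta> = 3 \<longrightarrow>
       (\<exists>e \<in> o[at_right 0](\<lambda>_. 1). \<forall>\<^sub>F t in at_right 0.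
          heat_kernel \<beta> (s, 0) t =
          complex_of_real (
            1 / (3 * 4 powr (1/3) * pi) * s powr (-2/3) * t powr (-1/3)
            * exp (- (3 / (8 * 4 powr (1/3))) * (s powr (4/3) / t powr (1/3))))
          * (complex_of_real
               (1 + cos (3 * sqrt 3 / (8 * 4 powr (1/3)) * (s powr (4/3) / t powr (1/3)) - pi/3))
             + e t)))
     \<and>
     (\<beta> > 3 \<longrightarrow>
       (\<lambda>t. heat_kernel \<beta> (s, 0) t) \<sim>[at_right 0]
       (\<lambda>t. complex_of_real (
          1 / (2 powr (7/6) * 3 powr (1/2) * pi)
          * \<beta> powr (-1/2) * (\<beta>\<^sup>2 - 1) powr (1/6)
          * s powr (-2/3) * t powr (-1/3)
          * exp (- (3 / 4 powr (4/3)) * (\<beta>\<^sup>2 - 1) powr (-1/3)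
                 * (s powr (4/3) / t powr (1/3))))))"
proof (intro conjI impI)
  assume "\<beta> < 0"
  with assms show "(\<lambda>t. heat_kernel \<beta> (s, s) t) \<sim>[at_right 0]
       (\<lambda>t. complex_of_real (
          1 / (3 powr (1/2) * 4 powr (1/3) * pi)
          * ((1 - \<beta>) powr (1/6) / ((3 - \<beta>) powr (1/2) * (1 + \<beta>) powr (1/6)))
          * s powr (-2/3) * t powr (-1/3)
          * exp (- (3 / 4 powr (4/3)) * ((1 + \<beta>) / (1 - \<beta>)) powr (1/3)
                 * (s powr (4/3) / t powr (1/3)))))"
    by (intro asymp_equivI' diagonal_asymptotics)
next
  have small: "e \<in> o[at_right 0](\<lambda>_. 1)" if "(e \<longlongrightarrow> 0) (at_right 0)" for e :: "real \<Rightarrow> complex"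
    by (rule smalloI_tendsto) (use that in auto)
  show "\<exists>e \<in> o[at_right 0](\<lambda>_. 1). \<forall>\<^sub>F t in at_right 0.
          heat_kernel \<beta> (s, s) t =
          complex_of_real (
            1 / (3 * 4 powr (1/3) * pi) * s powr (-2/3) * t powr (-1/3)
            * exp (- (3 / 4 powr (4/3)) * (s powr (4/3) / t powr (1/3))))
          * (complex_of_real
               (1 + cos (3 * sqrt 3 / 4 powr (4/3) * (s powr (4/3) / t powr (1/3)) - pi/3))
             + e t)" if "\<beta> = 0"
    using diagonal_beta_0_asymptotics[OF assms(2)] unfolding that by (blast intro: small)
  show "\<exists>e \<in> o[at_right 0](\<lambda>_. 1). \<forall>\<^sub>F t in at_right 0.
          heat_kernel \<beta> (s, 0) t =
          complex_of_real (
            1 / (3 * 4 powr (1/3) * pi) * s powr (-2/3) * t powr (-1/3)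
            * exp (- (3 / (8 * 4 powr (1/3))) * (s powr (4/3) / t powr (1/3))))
          * (complex_of_real
               (1 + cos (3 * sqrt 3 / (8 * 4 powr (1/3)) * (s powr (4/3) / t powr (1/3)) - pi/3))
             + e t)" if "\<beta> = 3"
    using axis_beta_3_asymptotics[OF assms(2)] unfolding that by (blast intro: small)
next
  assume "\<beta> > 3"
  with assms show "(\<lambda>t. heat_kernel \<beta> (s, 0) t) \<sim>[at_right 0]
       (\<lambda>t. complex_of_real (
          1 / (2 powr (7/6) * 3 powr (1/2) * pi)
          * \<beta> powr (-1/2) * (\<beta>\<^sup>2 - 1) powr (1/6)
          * s powr (-2/3) * t powr (-1/3)
          * exp (- (3 / 4 powr (4/3)) * (\<beta>\<^sup>2 - 1) powr (-1/3)
                 * (s powr (4/3) / t powr (1/3)))))"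
    by (intro asymp_equivI' axis_asymptotics)
qed

end
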